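(* Let $m,n\in\mathbb{N}$, and let $P\subseteq\mathbb{R}^m$ and $Q\subseteq\mathbb{R}^n\smallsetminus\{0\}$ satisfy one of the following: (a) $Q=\mathbb{Z}^n\smallsetminus\{0\}$ and $P$ is a subgroup of $\mathbb{Z}^m$ of rank $>m-n+1$; (b) $Q=(Q_1\times\cdots\times Q_n)\smallsetminus\{0\}$ with $Q_1,\dots,Q_n\subseteq\mathbb{Z}$, where at least two of the sets $Q_i$ are infinite, and $P\subseteq\mathbb{R}^m$ is at bounded Hausdorff distance from $\mathbb{R}^m$ (i.e. there is $R>0$ such that every point of $\mathbb{R}^m$ lies within distance $R$ of some point of $P$). Then the collection $\mathcal{L}_{P,Q}=\{L_{\mathbf p,\mathbf q}:\mathbf p\in P,\ \mathbf q\in Q\}$ is totally dense in $M_{m,n}$, and hence for every non-increasing function $\psi:\mathbb{R}_{>0}\to\mathbb{R}_{>0}$ and every countable collection $\mathcal{R}$ of proper analytic submanifolds of $M_{m,n}$, the set $\operatorname{UA}_{P,Q}(\psi)\smallsetminus\bigcup_{R\in\mathcal{R}}R$ is uncountable and dense in $M_{m,n}$.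
   Context: $M_{m,n}$ is the space of real $m\times n$ matrices. For $\mathbf p\in\mathbb{R}^m$ and $\mathbf q\in\mathbb{R}^n\smallsetminus\{0\}$, $L_{\mathbf p,\mathbf q}=\{A\in M_{m,n}: A\mathbf q=\mathbf p\}$ (a closed affine subspace of codimension $m$). A collection $\mathcal{L}$ of proper closed subsets of a topological space $X$ is dense if $\bigcup_{L\in\mathcal L}L$ is dense in $X$; it is totally dense if it is dense and, for every open $W\subseteq X$ and every $L\in\mathcal L$ with $L\cap W\neq\varnothing$, the closure of $\bigcup\{L'\in\mathcal L: L'\cap L\cap W\neq\varnothing\}$ has nonempty interior. Let $|\cdot|$ be the supremum norm. For $P\subseteq\mathbb{R}^m$, $Q\subseteq\mathbb{R}^n\smallsetminus\{0\}$ and non-increasing $\psi:\mathbb{R}_{>0}\to\mathbb{R}_{>0}$, $\operatorname{UA}_{P,Q}(\psi)$ is the set of $A\in M_{m,n}$ such that for all sufficiently large $t$ there exist $\mathbf p\in P$, $\mathbf q\in Q$ with $|A\mathbf q-\mathbf p|\le\psi(t)$ and $|\mathbf q|\le t$.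
   Formalization: In (b) the sets Q_i are assumed nonempty (an empty Q_i makes Q empty and the claim false), and a proper analytic submanifold means an embedded one of dimension less than mn (a proper open subset would make the density claim false). *)

theory Defs
  imports "HOL-Analysis.Analysis"
begin

definition dense_collection :: "'a::topological_space set set \<Rightarrow> bool" where
  "dense_collection \<L> \<longleftrightarrow> (\<forall>L\<in>\<L>. closed L \<and> L \<noteq> UNIV) \<and> closure (\<Union>\<L>) = UNIV"

definition totally_dense :: "'a::topological_space set set \<Rightarrow> bool" where
  "totally_dense \<L> \<longleftrightarrow> dense_collection \<L> \<and>
     (\<forall>W L. open W \<longrightarrow> L \<in> \<L> \<longrightarrow> L \<inter> W \<noteq> {} \<longrightarrow>
        interior (closure (\<Union>{L' \<in> \<L>. L' \<inter> L \<inter> W \<noteq> {}})) \<noteq> {})"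

definition solution_space :: "real^'m \<Rightarrow> real^'n \<Rightarrow> (real^'n^'m) set" where
  "solution_space p q = {A. A *v q = p}"

definition solution_spaces :: "(real^'m) set \<Rightarrow> (real^'n) set \<Rightarrow> (real^'n^'m) set set" where
  "solution_spaces P Q = {solution_space p q | p q. p \<in> P \<and> q \<in> Q}"

definition UA :: "(real^'m) set \<Rightarrow> (real^'n) set \<Rightarrow> (real \<Rightarrow> real) \<Rightarrow> (real^'n^'m) set" where
  "UA P Q \<psi> = {A. \<forall>\<^sub>F t in at_top. \<exists>p\<in>P. \<exists>q\<in>Q. infnorm (A *v q - p) \<le> \<psi> t \<and> infnorm q \<le> t}"

definition int_lattice :: "(real^'k) set" where
  "int_lattice = {x. \<forall>i. x $ i \<in> \<int>}"

definition add_subgroup :: "'a::ab_group_add set \<Rightarrow> bool" where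
  "add_subgroup G \<longleftrightarrow> 0 \<in> G \<and> (\<forall>x\<in>G. \<forall>y\<in>G. x + y \<in> G) \<and> (\<forall>x\<in>G. - x \<in> G)"

text \<open>The rank of an abelian group: the largest number of elements that are linearly
  independent over the integers. The maximum exists for subgroups of \<^term>\<open>int_lattice\<close>.\<close>

definition group_rank :: "'a::real_vector set \<Rightarrow> nat" where
  "group_rank G = Max {card B | B. B \<subseteq> G \<and> finite B \<and>
     \<not> module.dependent (\<lambda>(k::int) x. of_int k *\<^sub>R x) B}"

text \<open>Real analyticity: local expansion into a power series, summed over the multi-indices
  \<open>\<alpha>\<close>, which are the functions from \<^term>\<open>Basis\<close> to the natural numbers.\<close>

definition real_analytic_on ::
  "('a::euclidean_space \<Rightarrow> 'b::euclidean_space) \<Rightarrow> 'a set \<Rightarrow> bool" where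
  "real_analytic_on f U \<longleftrightarrow>
     (\<forall>x\<in>U. \<exists>r>0. \<exists>c :: ('a \<Rightarrow> nat) \<Rightarrow> 'b. \<forall>y\<in>ball x r.
        ((\<lambda>\<alpha>. (\<Prod>b\<in>Basis. ((y - x) \<bullet> b) ^ \<alpha> b) *\<^sub>R c \<alpha>) has_sum f y)
          (Basis \<rightarrow>\<^sub>E UNIV))"

definition analytic_submanifold :: "nat \<Rightarrow> 'a::euclidean_space set \<Rightarrow> bool" where
  "analytic_submanifold d S \<longleftrightarrow>
     (\<forall>x\<in>S. \<exists>U V (f :: 'a \<Rightarrow> 'a) g T.
        open U \<and> x \<in> U \<and> open V \<and> homeomorphism U V f g \<and>
        real_analytic_on f U \<and> real_analytic_on g V \<and>
        subspace T \<and> dim T = d \<and> f ` (S \<inter> U) = T \<inter> V)"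

text \<open>A submanifold is proper if its dimension is smaller than that of the ambient space.
  For closed submanifolds this is the same as not being the whole space; a submanifold that is
  not closed may be a proper open subset, which has to be excluded.\<close>

definition proper_analytic_submanifold :: "'a::euclidean_space set \<Rightarrow> bool" where
  "proper_analytic_submanifold S \<longleftrightarrow> (\<exists>d < DIM('a). analytic_submanifold d S)"

end

theory Submission
  imports Defs "HOL-Complex_Analysis.Cauchy_Integral_Formula"
begin

text \<open>
  Every matrix \<open>B\<close> admits arbitrarily large \<open>q' \<in> Q\<close>, pointing in directions bounded away from the
  line through a given \<open>q \<in> Q\<close>, such that \<open>B q'\<close> stays at bounded distance from \<open>P\<close>. In case (b),
  \<open>q'\<close> runs to infinity along a coordinate axis that does not contain \<open>q\<close>; in case (a), \<open>q'\<close>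
  approximates multiples of a vector \<open>v\<close> orthogonal to \<open>q\<close> with \<open>B v\<close> in the span of \<open>P\<close>, which
  exists by a dimension count. A rank-one perturbation of size \<open>O(1 / |q'|)\<close> then moves \<open>B\<close> onto some
  \<open>L' = L\<^bsub>p',q'\<^esub>\<close>, and if \<open>B\<close> is close to a point of \<open>L = L\<^bsub>p,q\<^esub>\<close>, the component of \<open>q'\<close> transversal to
  \<open>q\<close> yields a nearby point of \<open>L \<inter> L'\<close>. Hence the spaces \<open>L'\<close> meeting \<open>L\<close> near \<open>A \<in> L\<close> are dense in
  a neighbourhood of \<open>A\<close>.

  Khintchine's construction now gives points of \<open>UA\<close>: balls are nested so that, from the \<open>(k+1)\<close>-st
  one on, they lie so close to \<open>L\<^bsub>p_k,q_k\<^esub>\<close> that \<open>(p_k, q_k)\<close> serves all \<open>t\<close> between \<open>|q_k|\<close> and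
  \<open>|q_(k+1)|\<close>. The balls can also avoid the given submanifolds, because by analyticity a submanifold
  that contains a piece of \<open>L'\<close> near a point contains all of \<open>L'\<close> near it, which cannot happen for a
  dense set of \<open>L'\<close>. Uncountability follows by adding countably many points to the sets to be avoided.
\<close>

subsection \<open>Rank-one perturbations\<close>

definition rank_one :: "real^'m \<Rightarrow> real^'n \<Rightarrow> real^'n^'m" where
  "rank_one u w = (\<chi> i j. u $ i * w $ j)"

lemma rank_one_mult: "rank_one u w *v x = (w \<bullet> x) *\<^sub>R u"
  by (simp add: rank_one_def matrix_vector_mult_def vec_eq_iff inner_vec_def sum_distrib_left
      mult.assoc mult.commute mult.left_commute)

lemma norm_rank_one: "norm (rank_one u w) = norm u * norm w"
proof -
  have "rank_one u w = (\<chi> i. u $ i *\<^sub>R w)"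
    by (simp add: rank_one_def vec_eq_iff)
  hence "norm (rank_one u w) = L2_set (\<lambda>i. norm w * norm (u $ i)) UNIV"
    by (simp add: norm_vec_def[of "\<chi> i. u $ i *\<^sub>R w"] mult.commute)
  also have "\<dots> = norm w * norm u"
    by (simp add: L2_set_right_distrib[symmetric] norm_vec_def[of u])
  finally show ?thesis by simp
qed

lemma norm_matrix_vector_mult_le:
  fixes A :: "real^'n^'m"
  shows "norm (A *v x) \<le> norm A * norm x"
proof -
  have "norm (A *v x) = L2_set (\<lambda>i. \<bar>A $ i \<bullet> x\<bar>) UNIV"
    by (simp only: norm_vec_def[of "A *v x"]) (simp add: matrix_mult_dot)
  also have "\<dots> \<le> L2_set (\<lambda>i. norm x * norm (A $ i)) UNIV"
    by (intro L2_set_mono) (auto simp: mult.commute[of "norm x"] Cauchy_Schwarz_ineq2)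
  also have "\<dots> = norm x * norm A"
    by (simp add: L2_set_right_distrib[symmetric] norm_vec_def[of A])
  finally show ?thesis by (simp add: mult.commute)
qed

text \<open>Adding \<open>rank_one u w\<close> moves the value at \<open>q\<close> by
  \<open>(w \<bullet> q) *\<^sub>R u\<close>, so \<open>u\<close> is the defect
  \<open>p - A *v q\<close> divided by \<open>w \<bullet> w\<close>. The choice \<open>w = q\<close>
  costs least; a \<open>w\<close> orthogonal to another vector preserves the value there.\<close>

lemma exists_perturbation:
  fixes A :: "real^'n^'m"
  assumes "w \<bullet> q = w \<bullet> w" "w \<noteq> 0"
  obtains A' where "A' *v q = p" "\<And>x. w \<bullet> x = 0 \<Longrightarrow> A' *v x = A *v x"
    "dist A' A = norm (p - A *v q) / norm w"
proof
  let ?A' = "A + rank_one ((1 / (w \<bullet> w)) *\<^sub>R (p - A *v q)) w"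
  show "?A' *v q = p"
    using assms by (simp add: matrix_vector_mult_add_rdistrib rank_one_mult)
  show "?A' *v x = A *v x" if "w \<bullet> x = 0" for x
    using that by (simp add: matrix_vector_mult_add_rdistrib rank_one_mult)
  show "dist ?A' A = norm (p - A *v q) / norm w"
    using assms by (simp add: dist_norm norm_rank_one power2_norm_eq_inner[symmetric] power2_eq_square)
qed

section \<open>The affine spaces of solutions\<close>

lemma solution_space_closed:
  fixes p :: "real^'m" and q :: "real^'n"
  shows "closed (solution_space p q)"
proof -
  have "continuous_on UNIV (\<lambda>A::real^'n^'m. A *v q)"
    unfolding matrix_vector_mult_def by (intro continuous_intros)
  thus ?thesis
    unfolding solution_space_def by (intro closed_Collect_eq continuous_on_const)
qed

lemma solution_space_proper:
  assumes "q \<noteq> 0"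
  shows "solution_space p q \<noteq> (UNIV :: (real^'n^'m) set)"
proof
  assume U: "solution_space p q = (UNIV :: (real^'n^'m) set)"
  obtain A :: "real^'n^'m" where "A *v q = p + 1"
    using exists_perturbation[of q q "p + 1"] assms by metis
  moreover have "A *v q = p" using U by (auto simp: solution_space_def)
  ultimately show False by (simp add: vec_eq_iff)
qed

subsection \<open>Approximation in directions transversal to every point of \<open>Q\<close>\<close>

text \<open>Here \<open>\<delta>\<close>, which depends on \<open>q\<close> alone, bounds the
  distance from \<open>v\<close> to the line of \<open>q\<close>, while \<open>v\<close> and
  \<open>C\<close> may vary with \<open>A\<close>. The sign of \<open>t\<close> is free because an
  infinite set of integers may be unbounded on one side only.\<close>

definition approximable :: "(real^'m) set \<Rightarrow> (real^'n) set \<Rightarrow> bool" where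
  "approximable P Q \<longleftrightarrow> (\<forall>q\<in>Q. \<exists>\<delta>>0. \<forall>A. \<exists>v C. norm v = 1 \<and> (\<forall>s. \<delta> \<le> norm (v - s *\<^sub>R q)) \<and>
     (\<forall>T. \<exists>t p' q'. T \<le> \<bar>t\<bar> \<and> p' \<in> P \<and> q' \<in> Q \<and>
        norm (q' - t *\<^sub>R v) \<le> C \<and> norm (A *v q' - p') \<le> C))"

text \<open>Passage to relative errors: for large \<open>\<bar>t\<bar>\<close> the fixed error
  \<open>C\<close> is small against \<open>norm q'\<close>, and halving \<open>\<delta>\<close>
  absorbs its effect on the direction.\<close>

lemma approximableE:
  fixes q :: "real^'n" and P :: "(real^'m) set"
  assumes "approximable P Q" "q \<in> Q"
  obtains \<delta> where "\<delta> > 0"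
    "\<And>A \<epsilon> N. \<epsilon> > 0 \<Longrightarrow> \<exists>p'\<in>P. \<exists>q'\<in>Q. N \<le> norm q' \<and> norm (A *v q' - p') \<le> \<epsilon> * norm q' \<and>
       (\<forall>s. \<delta> * norm q' \<le> norm (q' - s *\<^sub>R q))"
proof -
  from assms obtain \<delta> where \<delta>: "\<delta> > 0" and H: "\<And>A. \<exists>v C. norm v = 1 \<and> (\<forall>s. \<delta> \<le> norm (v - s *\<^sub>R q)) \<and>
     (\<forall>T. \<exists>t p' q'. T \<le> \<bar>t\<bar> \<and> p' \<in> P \<and> q' \<in> Q \<and>
        norm (q' - t *\<^sub>R v) \<le> C \<and> norm (A *v q' - p') \<le> C)"
    unfolding approximable_def by blast
  show thesis
  proof (rule that[of "\<delta> / 2"])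
    show "\<delta> / 2 > 0" using \<delta> by simp
    fix A :: "real^'n^'m" and \<epsilon> N :: real assume "\<epsilon> > 0"
    obtain v C where v: "norm v = 1" "\<And>s. \<delta> \<le> norm (v - s *\<^sub>R q)"
      and C: "\<And>T. \<exists>t p' q'. T \<le> \<bar>t\<bar> \<and> p' \<in> P \<and> q' \<in> Q \<and>
        norm (q' - t *\<^sub>R v) \<le> C \<and> norm (A *v q' - p') \<le> C"
      using H[of A] by blast
    \<comment> \<open>The entries secure, in order, \<open>t \<noteq> 0\<close>,
      \<open>N \<le> norm q'\<close>, \<open>C \<le> \<epsilon> * norm q'\<close> and
      \<open>\<delta> / 2 * (\<bar>t\<bar> + C) \<le> \<bar>t\<bar> * \<delta> - C\<close>.\<close>
    obtain t p' q' where t: "Max {1, C + N, C + C / \<epsilon>, C * (2 / \<delta> + 1)} \<le> \<bar>t\<bar>"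
      and pq: "p' \<in> P" "q' \<in> Q" "norm (q' - t *\<^sub>R v) \<le> C" "norm (A *v q' - p') \<le> C"
      using C by blast
    have t': "1 \<le> \<bar>t\<bar>" "C + N \<le> \<bar>t\<bar>" "C + C / \<epsilon> \<le> \<bar>t\<bar>" "C * (2 / \<delta> + 1) \<le> \<bar>t\<bar>"
      using t by simp_all
    have lo: "\<bar>t\<bar> - C \<le> norm q'"
      using norm_triangle_ineq2[of "t *\<^sub>R v" q'] pq v by (simp add: norm_minus_commute)
    have up: "norm q' \<le> \<bar>t\<bar> + C"
      using norm_triangle_ineq2[of q' "t *\<^sub>R v"] pq v by simp
    have "C / \<epsilon> \<le> norm q'" using t' lo by linarith
    hence "C \<le> \<epsilon> * norm q'" using \<open>\<epsilon> > 0\<close> by (simp add: field_simps)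
    moreover have "\<delta> / 2 * norm q' \<le> norm (q' - s *\<^sub>R q)" for s
    proof -
      have "\<bar>t\<bar> * \<delta> \<le> \<bar>t\<bar> * norm (v - (s / t) *\<^sub>R q)"
        using v by (intro mult_left_mono) auto
      also have "\<dots> = norm (t *\<^sub>R (v - (s / t) *\<^sub>R q))" by simp
      also have "t *\<^sub>R (v - (s / t) *\<^sub>R q) = t *\<^sub>R v - s *\<^sub>R q"
        using t' by (auto simp: scaleR_diff_right)
      also have "norm \<dots> \<le> norm (q' - s *\<^sub>R q) + norm (q' - t *\<^sub>R v)"
        using norm_triangle_ineq4[of "q' - s *\<^sub>R q" "q' - t *\<^sub>R v"] by simp
      finally have "\<bar>t\<bar> * \<delta> - C \<le> norm (q' - s *\<^sub>R q)" using pq by linarith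
      moreover have "C * (2 / \<delta> + 1) * (\<delta> / 2) \<le> \<bar>t\<bar> * (\<delta> / 2)"
        using t' \<delta> by (intro mult_right_mono) auto
      moreover have "C * (2 / \<delta> + 1) * (\<delta> / 2) = C + C * \<delta> / 2"
        using \<delta> by (simp add: field_simps)
      moreover have "\<delta> / 2 * norm q' \<le> \<delta> / 2 * (\<bar>t\<bar> + C)"
        using up \<delta> by (intro mult_left_mono) auto
      ultimately show ?thesis by (simp add: field_simps)
    qed
    moreover have "N \<le> norm q'" using t' lo by linarith
    ultimately show "\<exists>p'\<in>P. \<exists>q'\<in>Q. N \<le> norm q' \<and> norm (A *v q' - p') \<le> \<epsilon> * norm q' \<and>
       (\<forall>s. \<delta> / 2 * norm q' \<le> norm (q' - s *\<^sub>R q))"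
      using pq by (smt (verit))
  qed
qed

section \<open>Density of the solution spaces, globally and along a given one\<close>

lemma solution_spaces_dense:
  fixes B :: "real^'n^'m"
  assumes "approximable P Q" "Q \<noteq> {}" "\<epsilon> > 0"
  obtains p q A where "p \<in> P" "q \<in> Q" "A \<in> solution_space p q" "dist A B < \<epsilon>"
proof -
  from \<open>Q \<noteq> {}\<close> obtain q0 where "q0 \<in> Q" by blast
  obtain \<delta> where H: "\<And>A \<epsilon> N. \<epsilon> > 0 \<Longrightarrow> \<exists>p'\<in>P. \<exists>q'\<in>Q. N \<le> norm q' \<and>
      norm ((A::real^'n^'m) *v q' - p') \<le> \<epsilon> * norm q' \<and> (\<forall>s. \<delta> * norm q' \<le> norm (q' - s *\<^sub>R q0))"
    using approximableE[OF assms(1) \<open>q0 \<in> Q\<close>] by metis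
  obtain p q where pq: "p \<in> P" "q \<in> Q" "1 \<le> norm q" "norm (B *v q - p) \<le> \<epsilon> / 2 * norm q"
    using H[of "\<epsilon> / 2" 1 B] \<open>\<epsilon> > 0\<close> by auto
  have "q \<noteq> 0" using pq by auto
  then obtain A where A: "A *v q = p" "dist A B = norm (p - B *v q) / norm q"
    using exists_perturbation[of q q p B] by metis
  have "dist A B \<le> \<epsilon> / 2"
    using A pq \<open>q \<noteq> 0\<close> by (metis norm_minus_commute pos_divide_le_eq zero_less_norm_iff)
  hence "dist A B < \<epsilon>" using \<open>\<epsilon> > 0\<close> by linarith
  thus thesis
    using pq A(1) by (intro that[of p q A]) (simp_all add: solution_space_def)
qed

text \<open>One pair \<open>(p', q')\<close> yields both points: moving \<open>B\<close> along
  \<open>q'\<close> gives \<open>B'\<close>, and moving \<open>A\<close> along the component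
  \<open>w\<close> of \<open>q'\<close> orthogonal to \<open>q\<close> gives \<open>A'\<close>
  without leaving \<open>solution_space p q\<close>. As \<open>norm w\<close> is at least
  \<open>\<delta> * norm q'\<close>, the second move costs less than \<open>r\<close>; half of this
  allowance is spent on \<open>norm (B - A)\<close>, half on the error of \<open>(p', q')\<close> at
  \<open>B\<close>.\<close>

lemma solution_spaces_locally_dense:
  fixes A :: "real^'n^'m"
  assumes "approximable P Q" "q \<in> Q" "q \<noteq> 0" "A \<in> solution_space p q" "r > 0"
  obtains \<rho> where "\<rho> > 0"
    "\<And>B \<epsilon> N. B \<in> ball A \<rho> \<Longrightarrow> \<epsilon> > 0 \<Longrightarrow> \<exists>p'\<in>P. \<exists>q'\<in>Q. \<exists>A' B'. N \<le> norm q' \<and>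
       A' \<in> solution_space p' q' \<inter> solution_space p q \<inter> ball A r \<and>
       B' \<in> solution_space p' q' \<inter> ball B \<epsilon>"
proof -
  obtain \<delta> where \<delta>: "\<delta> > 0" and H: "\<And>A \<epsilon> N. \<epsilon> > 0 \<Longrightarrow> \<exists>p'\<in>P. \<exists>q'\<in>Q. N \<le> norm q' \<and>
      norm ((A::real^'n^'m) *v q' - p') \<le> \<epsilon> * norm q' \<and> (\<forall>s. \<delta> * norm q' \<le> norm (q' - s *\<^sub>R q))"
    using approximableE[OF assms(1,2)] by metis
  show thesis
  proof (rule that[of "\<delta> * r / 2"])
    show "\<delta> * r / 2 > 0" using \<delta> \<open>r > 0\<close> by simp
    fix B \<epsilon> N assume B: "B \<in> ball A (\<delta> * r / 2)" and "(\<epsilon>::real) > 0"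
    define e where "e = min (\<epsilon> / 2) (\<delta> * r / 2)"
    have e: "e > 0" "e \<le> \<epsilon> / 2" "e \<le> \<delta> * r / 2" using \<open>\<epsilon> > 0\<close> \<delta> \<open>r > 0\<close> by (auto simp: e_def)
    obtain p' q' where pq: "p' \<in> P" "q' \<in> Q" "max 1 N \<le> norm q'"
        "norm (B *v q' - p') \<le> e * norm q'" and tr: "\<And>s. \<delta> * norm q' \<le> norm (q' - s *\<^sub>R q)"
      using H[OF e(1)] by meson
    have q': "q' \<noteq> 0" "norm q' > 0" using pq by auto
    obtain B' where B': "B' *v q' = p'" "dist B' B = norm (p' - B *v q') / norm q'"
      using exists_perturbation[of q' q' p' B] q' by metis
    have "dist B' B \<le> e"
      using B' pq q' by (simp add: pos_divide_le_eq norm_minus_commute)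
    define w where "w = q' - ((q' \<bullet> q) / (q \<bullet> q)) *\<^sub>R q"
    have wq: "w \<bullet> q = 0" using \<open>q \<noteq> 0\<close> by (simp add: w_def inner_diff_left)
    have "w \<bullet> q' = w \<bullet> (w + ((q' \<bullet> q) / (q \<bullet> q)) *\<^sub>R q)" by (simp add: w_def)
    also have "\<dots> = w \<bullet> w" using wq by (simp add: inner_add_right del: inner_commute)
    finally have ww: "w \<bullet> q' = w \<bullet> w" .
    have lw: "\<delta> * norm q' \<le> norm w" using tr by (simp add: w_def)
    hence w0: "norm w > 0" using \<delta> q' by (smt (verit) mult_pos_pos)
    then obtain A' where A': "A' *v q' = p'" "A' *v q = A *v q" "dist A' A = norm (p' - A *v q') / norm w"
      using exists_perturbation[OF ww, of p' A] wq by (metis norm_zero less_irrefl)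
    have "norm (p' - A *v q') \<le> norm (B *v q' - p') + norm ((B - A) *v q')"
    proof -
      have "p' - A *v q' = (B - A) *v q' - (B *v q' - p')"
        by (simp add: matrix_vector_mult_diff_rdistrib)
      thus ?thesis by (metis add.commute norm_triangle_ineq4)
    qed
    also have "norm ((B - A) *v q') \<le> norm (B - A) * norm q'"
      by (rule norm_matrix_vector_mult_le)
    also have "norm (B *v q' - p') + norm (B - A) * norm q' < \<delta> * r / 2 * norm q' + \<delta> * r / 2 * norm q'"
    proof (rule add_le_less_mono)
      show "norm (B *v q' - p') \<le> \<delta> * r / 2 * norm q'"
        using pq(4) e(3) q' by (meson mult_right_mono norm_ge_zero order_trans)
      show "norm (B - A) * norm q' < \<delta> * r / 2 * norm q'"
        using B q' by (intro mult_strict_right_mono) (auto simp: dist_norm norm_minus_commute)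
    qed
    also have "\<dots> = r * (\<delta> * norm q')" by (simp add: algebra_simps)
    also have "\<dots> \<le> r * norm w" using lw \<open>r > 0\<close> by (intro mult_left_mono) auto
    finally have "dist A' A < r" using w0 A' by (simp add: pos_divide_less_eq)
    hence "A' \<in> solution_space p' q' \<inter> solution_space p q \<inter> ball A r"
      using A' assms(4) by (simp add: solution_space_def dist_commute)
    moreover have "B' \<in> solution_space p' q' \<inter> ball B \<epsilon>"
      using B' \<open>dist B' B \<le> e\<close> e \<open>\<epsilon> > 0\<close> by (simp add: solution_space_def dist_commute)
    moreover have "N \<le> norm q'" using pq by simp
    ultimately show "\<exists>p'\<in>P. \<exists>q'\<in>Q. \<exists>A' B'. N \<le> norm q' \<and>
       A' \<in> solution_space p' q' \<inter> solution_space p q \<inter> ball A r \<and>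
       B' \<in> solution_space p' q' \<inter> ball B \<epsilon>"
      using pq by blast
  qed
qed

lemma approximable_imp_totally_dense:
  fixes P :: "(real^'m) set" and Q :: "(real^'n) set"
  assumes "approximable P Q" "Q \<noteq> {}" "0 \<notin> Q"
  shows "totally_dense (solution_spaces P Q)"
  unfolding totally_dense_def dense_collection_def
proof (intro conjI ballI allI impI)
  fix L assume "L \<in> solution_spaces P Q"
  then obtain p q where "q \<in> Q" "L = solution_space p q"
    by (auto simp: solution_spaces_def)
  moreover have "q \<noteq> 0" using \<open>q \<in> Q\<close> \<open>0 \<notin> Q\<close> by blast
  ultimately show "closed L" "L \<noteq> UNIV"
    by (simp_all only: solution_space_closed solution_space_proper not_False_eq_True)
next
  have "B \<in> closure (\<Union> (solution_spaces P Q))" for B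
    unfolding closure_approachable
  proof (intro allI impI)
    fix e :: real assume "e > 0"
    then obtain p q A where "p \<in> P" "q \<in> Q" "A \<in> solution_space p q" "dist A B < e"
      using solution_spaces_dense[OF assms(1,2)] by metis
    thus "\<exists>y\<in>\<Union> (solution_spaces P Q). dist y B < e"
      by (auto simp: solution_spaces_def)
  qed
  thus "closure (\<Union> (solution_spaces P Q)) = UNIV" by auto
next
  fix W L assume W: "open W" and L: "L \<in> solution_spaces P Q" "L \<inter> W \<noteq> {}"
  then obtain p q A where pq: "q \<in> Q" "L = solution_space p q" "A \<in> L" "A \<in> W"
    by (auto simp: solution_spaces_def)
  obtain r where r: "r > 0" "ball A r \<subseteq> W" using W pq openE by blast
  obtain \<rho> where \<rho>: "\<rho> > 0"
    "\<And>B \<epsilon> N. B \<in> ball A \<rho> \<Longrightarrow> \<epsilon> > 0 \<Longrightarrow> \<exists>p'\<in>P. \<exists>q'\<in>Q. \<exists>A' B'. N \<le> norm q' \<and>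
       A' \<in> solution_space p' q' \<inter> solution_space p q \<inter> ball A r \<and>
       B' \<in> solution_space p' q' \<inter> ball B \<epsilon>"
  proof (rule solution_spaces_locally_dense[OF assms(1) pq(1) _ _ r(1), of A p])
    show "q \<noteq> 0" "A \<in> solution_space p q" using pq assms(3) by auto
  qed (rule that)
  have "ball A \<rho> \<subseteq> closure (\<Union> {L' \<in> solution_spaces P Q. L' \<inter> L \<inter> W \<noteq> {}})"
  proof
    fix B assume B: "B \<in> ball A \<rho>"
    show "B \<in> closure (\<Union> {L' \<in> solution_spaces P Q. L' \<inter> L \<inter> W \<noteq> {}})"
      unfolding closure_approachable
    proof (intro allI impI)
      fix e :: real assume "e > 0"
      then obtain p' q' A' B' where "p' \<in> P" "q' \<in> Q"
        "A' \<in> solution_space p' q' \<inter> solution_space p q \<inter> ball A r"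
        "B' \<in> solution_space p' q' \<inter> ball B e"
        using \<rho>(2)[OF B] by blast
      note * = this
      have "solution_space p' q' \<in> solution_spaces P Q"
        using *(1,2) unfolding solution_spaces_def by blast
      moreover have "A' \<in> solution_space p' q' \<inter> L \<inter> W"
        using *(3) pq(2) r(2) by blast
      ultimately have "B' \<in> \<Union> {L' \<in> solution_spaces P Q. L' \<inter> L \<inter> W \<noteq> {}}"
        using *(4) by blast
      moreover have "dist B' B < e" using *(4) by (simp add: dist_commute)
      ultimately show "\<exists>y\<in>\<Union> {L' \<in> solution_spaces P Q. L' \<inter> L \<inter> W \<noteq> {}}. dist y B < e"
        by (rule bexI[rotated])
    qed
  qed
  hence "ball A \<rho> \<subseteq> interior (closure (\<Union> {L' \<in> solution_spaces P Q. L' \<inter> L \<inter> W \<noteq> {}}))"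
    by (intro interior_maximal) auto
  moreover have "A \<in> ball A \<rho>" using \<rho>(1) by simp
  ultimately show "interior (closure (\<Union> {L' \<in> solution_spaces P Q. L' \<inter> L \<inter> W \<noteq> {}})) \<noteq> {}"
    by blast
qed

subsection \<open>Product sets\<close>

text \<open>Only one coordinate \<open>l\<close> of \<open>q'\<close> varies, the others being
  frozen at chosen elements of their factors, so \<open>q'\<close> stays within
  \<open>norm e\<close> of a multiple of \<open>axis l 1\<close>.\<close>

lemma approximable_product:
  fixes P :: "(real^'m) set" and Qs :: "'n::finite \<Rightarrow> int set"
  assumes ne: "\<And>i. Qs i \<noteq> {}" and inf: "i \<noteq> j" "infinite (Qs i)" "infinite (Qs j)"
    and P: "\<And>x. \<exists>p\<in>P. dist x p \<le> R"
  shows "approximable P ({q. \<forall>i. q $ i \<in> real_of_int ` Qs i} - {0})"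
    (is "approximable P ?Q")
  unfolding approximable_def
proof (rule ballI)
  fix q assume "q \<in> ?Q"
  then obtain k where k: "q $ k \<noteq> 0" by (auto simp: vec_eq_iff)
  \<comment> \<open>At least one of the two infinite factors has an index other than
    \<open>k\<close>; its axis is then off the line of \<open>q\<close>, whose coordinate at
    \<open>k\<close> is nonzero.\<close>
  obtain l where l: "l \<noteq> k" "infinite (Qs l)" using inf by metis
  let ?v = "axis l 1 :: real^'n"
  have "?v \<notin> span {q}"
  proof
    assume "?v \<in> span {q}"
    then obtain s where s: "?v = s *\<^sub>R q" by (auto simp: span_singleton)
    from arg_cong[OF s, of "\<lambda>x. x $ k"] have "s = 0" using l(1) k by (simp add: axis_def)
    with arg_cong[OF s, of "\<lambda>x. x $ l"] show False by (simp add: axis_def)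
  qed
  from separate_point_closed[OF closed_span this] obtain \<delta> where
    \<delta>: "\<delta> > 0" "\<And>y. y \<in> span {q} \<Longrightarrow> \<delta> \<le> dist ?v y" by blast
  define c where "c i = (SOME z. z \<in> Qs i)" for i
  have c: "c i \<in> Qs i" for i using ne[of i] by (simp add: c_def some_in_eq)
  define e :: "real^'n" where "e = (\<chi> i. if i = l then 0 else real_of_int (c i))"
  define C where "C = max (norm e) R"
  have far: "\<exists>t p' q'. T \<le> \<bar>t\<bar> \<and> p' \<in> P \<and> q' \<in> ?Q \<and>
      norm (q' - t *\<^sub>R ?v) \<le> C \<and> norm (A *v q' - p') \<le> C" for A :: "real^'n^'m" and T
  proof -
    \<comment> \<open>An infinite set of integers leaves every bounded interval; the
      \<open>1\<close> in \<open>max 1 T\<close> makes coordinate \<open>l\<close> of the new point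
      nonzero.\<close>
    have "\<not> Qs l \<subseteq> {- \<lceil>max 1 T\<rceil>..\<lceil>max 1 T\<rceil>}"
      using l(2) finite_subset by blast
    then obtain z where "z \<in> Qs l" "z \<notin> {- \<lceil>max 1 T\<rceil>..\<lceil>max 1 T\<rceil>}" by blast
    moreover from this have "\<lceil>max 1 T\<rceil> \<le> \<bar>z\<bar>" by auto
    ultimately have z: "z \<in> Qs l" "max 1 T \<le> \<bar>real_of_int z\<bar>"
      by (simp_all only: ceiling_le_iff of_int_abs)
    let ?q = "real_of_int z *\<^sub>R ?v + e"
    obtain p' where "p' \<in> P" "dist (A *v ?q) p' \<le> R" using P by blast
    moreover have "?q $ i \<in> real_of_int ` Qs i" for i
      using z(1) c[of i] by (cases "i = l") (auto simp: e_def axis_def)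
    moreover have "?q $ l \<noteq> 0" using z(2) by (auto simp: e_def)
    hence "?q \<noteq> 0" by (metis zero_index)
    ultimately show ?thesis
      using z(2) by (intro exI[of _ "real_of_int z"] exI[of _ p'] exI[of _ ?q])
        (simp add: C_def dist_norm le_max_iff_disj)
  qed
  have "\<delta> \<le> norm (?v - s *\<^sub>R q)" for s
    using \<delta>(2)[of "s *\<^sub>R q"] by (simp add: dist_norm span_base span_scale)
  hence "\<exists>v C. norm v = 1 \<and> (\<forall>s. \<delta> \<le> norm (v - s *\<^sub>R q)) \<and>
     (\<forall>T. \<exists>t p' q'. T \<le> \<bar>t\<bar> \<and> p' \<in> P \<and> q' \<in> ?Q \<and>
        norm (q' - t *\<^sub>R v) \<le> C \<and> norm (A *v q' - p') \<le> C)" for A :: "real^'n^'m"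
    using far[of _ A] by - (rule exI[of _ ?v], rule exI[of _ C], simp add: norm_axis_1)
  with \<delta>(1) show "\<exists>\<delta>>0. \<forall>A::real^'n^'m. \<exists>v C. norm v = 1 \<and> (\<forall>s. \<delta> \<le> norm (v - s *\<^sub>R q)) \<and>
     (\<forall>T. \<exists>t p' q'. T \<le> \<bar>t\<bar> \<and> p' \<in> P \<and> q' \<in> ?Q \<and>
        norm (q' - t *\<^sub>R v) \<le> C \<and> norm (A *v q' - p') \<le> C)"
    by - (rule exI[of _ \<delta>], intro conjI allI)
qed

subsection \<open>Subgroups of the integer lattice\<close>

lemma common_denominator:
  fixes u :: "'a \<Rightarrow> rat"
  assumes "finite t"
  shows "\<exists>D::int. D > 0 \<and> (\<forall>v\<in>t. of_int D * u v \<in> \<int>)"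
  using assms
proof induction
  case empty
  show ?case by (intro exI[of _ 1]) simp
next
  case (insert x t)
  then obtain D :: int where D: "D > 0" "\<And>v. v \<in> t \<Longrightarrow> of_int D * u v \<in> \<int>" by blast
  obtain a b where ab: "quotient_of (u x) = (a, b)" by fastforce
  hence b: "b > 0" "u x = of_int a / of_int b"
    using quotient_of_denom_pos quotient_of_div by auto
  have "of_int (D * b) * u v \<in> \<int>" if "v \<in> insert x t" for v
  proof (cases "v = x")
    case True
    have "of_int (D * b) * u x = of_int (D * a)" using b by simp
    thus ?thesis using True by (metis Ints_of_int)
  next
    case False
    hence "v \<in> t" using that by simp
    have "of_int b * (of_int D * u v) \<in> \<int>" by (rule Ints_mult[OF Ints_of_int D(2)[OF \<open>v \<in> t\<close>]])
    thus ?thesis by (simp add: mult_ac)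
  qed
  thus ?case using D(1) b(1) by (intro exI[of _ "D * b"]) simp
qed

lemma module_int: "module (\<lambda>(k::int) (x::'a::real_vector). of_int k *\<^sub>R x)"
  by unfold_locales (auto simp: scaleR_add_right scaleR_add_left)

lemma vector_space_rat: "vector_space (\<lambda>(k::rat) (x::'a::real_vector). of_rat k *\<^sub>R x)"
  by unfold_locales (auto simp: scaleR_add_right scaleR_add_left of_rat_add of_rat_mult)

text \<open>Multiplying a rational relation by a common denominator of its coefficients gives an
  integer one.\<close>

lemma int_independent_imp_rat_independent:
  fixes B :: "'a::real_vector set"
  assumes "\<not> module.dependent (\<lambda>(k::int) x. of_int k *\<^sub>R x) B"
  shows "\<not> module.dependent (\<lambda>(k::rat) x. of_rat k *\<^sub>R x) B"
proof
  interpret Z: module "\<lambda>(k::int) (x::'a). of_int k *\<^sub>R x" by (rule module_int)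
  interpret V: vector_space "\<lambda>(k::rat) (x::'a). of_rat k *\<^sub>R x" by (rule vector_space_rat)
  assume "V.dependent B"
  then obtain t u v where t: "finite t" "t \<subseteq> B" "(\<Sum>v\<in>t. of_rat (u v) *\<^sub>R v) = 0" "v \<in> t" "u v \<noteq> 0"
    unfolding V.dependent_explicit by blast
  obtain D :: int where D: "D > 0" "\<And>v. v \<in> t \<Longrightarrow> of_int D * u v \<in> \<int>"
    using common_denominator[OF t(1), of u] by blast
  define w :: "'a \<Rightarrow> int" where "w v = \<lfloor>of_int D * u v\<rfloor>" for v
  have w: "of_int (w v) = of_int D * u v" if "v \<in> t" for v
    using D(2)[OF that] by (auto simp: w_def elim: Ints_cases)
  have wr: "real_of_int (w v) = of_int D * of_rat (u v)" if "v \<in> t" for v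
    using arg_cong[OF w[OF that], of "of_rat :: rat \<Rightarrow> real"] by (simp add: of_rat_mult)
  have "(\<Sum>v\<in>t. of_int (w v) *\<^sub>R v) = (\<Sum>v\<in>t. of_int D *\<^sub>R of_rat (u v) *\<^sub>R v)"
    by (rule sum.cong) (simp_all add: wr)
  also have "\<dots> = of_int D *\<^sub>R (\<Sum>v\<in>t. of_rat (u v) *\<^sub>R v)" by (simp only: scaleR_sum_right)
  also have "\<dots> = 0" by (simp only: t(3) scaleR_zero_right)
  finally have "(\<Sum>v\<in>t. of_int (w v) *\<^sub>R v) = 0" .
  moreover have "w v \<noteq> 0" using w[OF t(4)] D(1) t(5) by auto
  ultimately have "Z.dependent B"
    unfolding Z.dependent_explicit using t(1,2,4) by (intro exI[of _ t] exI[of _ w]) auto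
  with assms show False by simp
qed

text \<open>A rational functional that is dual to an element of \<open>B\<close> agrees on the lattice with the real
  linear functional that has the same values on the coordinate vectors.\<close>

lemma int_independent_imp_independent:
  fixes B :: "(real^'k) set"
  assumes "B \<subseteq> int_lattice" "\<not> module.dependent (\<lambda>(k::int) x. of_int k *\<^sub>R x) B"
  shows "independent B"
proof
  interpret V: vector_space "\<lambda>(k::rat) (x::real^'k). of_rat k *\<^sub>R x" by (rule vector_space_rat)
  interpret W: vector_space "\<lambda>(k::rat) (x::real). of_rat k *\<^sub>R x" by (rule vector_space_rat)
  interpret VW: vector_space_pair "\<lambda>(k::rat) (x::real^'k). of_rat k *\<^sub>R x"
    "\<lambda>(k::rat) (x::real). of_rat k *\<^sub>R x" ..
  assume "dependent B"
  then obtain t u v where t: "finite t" "t \<subseteq> B" "(\<Sum>v\<in>t. u v *\<^sub>R v) = 0" "v \<in> t" "u v \<noteq> 0"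
    unfolding dependent_explicit by blast
  obtain g where "Vector_Spaces.linear (\<lambda>(k::rat) (x::real^'k). of_rat k *\<^sub>R x)
      (\<lambda>(k::rat) (x::real). of_rat k *\<^sub>R x) g"
    and g: "\<And>x. x \<in> B \<Longrightarrow> g x = (if x = v then 1 else 0)"
    using VW.linear_independent_extend[OF int_independent_imp_rat_independent[OF assms(2)],
        of "\<lambda>x. if x = v then 1 else 0"] by blast
  then interpret g: Vector_Spaces.linear "\<lambda>(k::rat) (x::real^'k). of_rat k *\<^sub>R x"
    "\<lambda>(k::rat) (x::real). of_rat k *\<^sub>R x" g by simp
  have lattice: "g x = (\<Sum>i\<in>UNIV. x $ i * g (axis i 1))" if "x \<in> int_lattice" for x
  proof -
    have "\<forall>i. \<exists>k. x $ i = of_int k"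
      using that unfolding int_lattice_def by (auto elim: Ints_cases)
    then obtain k where k: "\<And>i. x $ i = of_int (k i)" by metis
    have "x = (\<Sum>i\<in>UNIV. of_rat (of_int (k i)) *\<^sub>R axis i 1)"
      by (simp add: vec_eq_iff k axis_def if_distrib cong: if_cong)
    hence "g x = (\<Sum>i\<in>UNIV. g (of_rat (of_int (k i)) *\<^sub>R axis i 1))"
      using g.sum[of "\<lambda>i. of_rat (of_int (k i)) *\<^sub>R axis i 1" UNIV] by (simp only:)
    also have "\<dots> = (\<Sum>i\<in>UNIV. of_rat (of_int (k i)) *\<^sub>R g (axis i 1))"
      by (simp only: g.scale)
    finally have "g x = (\<Sum>i\<in>UNIV. of_rat (of_int (k i)) *\<^sub>R g (axis i 1))" .
    thus ?thesis by (simp add: k)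
  qed
  \<comment> \<open>The real functional with values \<open>g (axis i 1)\<close> is applied to the
    vanishing combination. On each element of \<open>t\<close> it equals \<open>g\<close>, so only
    the coefficient of \<open>v\<close> survives.\<close>
  have "0 = (\<Sum>i\<in>UNIV. (\<Sum>w\<in>t. u w *\<^sub>R w) $ i * g (axis i 1))" using t(3) by simp
  also have "\<dots> = (\<Sum>w\<in>t. u w * (\<Sum>i\<in>UNIV. w $ i * g (axis i 1)))"
    by (simp add: sum_component sum_distrib_left sum_distrib_right mult.assoc)
      (rule sum.swap)
  also have "\<dots> = (\<Sum>w\<in>t. if w = v then u w else 0)"
  proof (rule sum.cong)
    fix w assume "w \<in> t"
    hence "w \<in> B" using t(2) by blast
    thus "u w * (\<Sum>i\<in>UNIV. w $ i * g (axis i 1)) = (if w = v then u w else 0)"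
      using lattice[of w] g[of w] assms(1) by auto
  qed simp
  also have "\<dots> = u v" using t(1,4) by simp
  finally show False using t(5) by simp
qed

text \<open>The \<open>Max\<close> is taken over a finite nonempty set: subsets of the lattice that
  are independent over the integers are so over the reals, which bounds their sizes by the
  dimension, and the empty set is one of them.\<close>

lemma group_rank_attained:
  fixes G :: "(real^'k) set"
  assumes "G \<subseteq> int_lattice"
  obtains B where "B \<subseteq> G" "finite B" "independent B" "card B = group_rank G"
proof -
  let ?N = "{card B | B. B \<subseteq> G \<and> finite B \<and> \<not> module.dependent (\<lambda>(k::int) x. of_int k *\<^sub>R x) B}"
  interpret Z: module "\<lambda>(k::int) (x::real^'k). of_int k *\<^sub>R x" by (rule module_int)
  have ind: "independent B" if "B \<subseteq> G" "Z.independent B" for B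
    using int_independent_imp_independent[OF order_trans[OF that(1) assms] that(2)] .
  have "?N \<subseteq> {..CARD('k)}"
  proof
    fix k assume "k \<in> ?N"
    then obtain B where "k = card B" "B \<subseteq> G" "Z.independent B"
      unfolding mem_Collect_eq by (elim exE conjE)
    thus "k \<in> {..CARD('k)}" using independent_bound[OF ind] by simp
  qed
  hence "finite ?N" by (rule finite_subset) simp
  moreover have "0 \<in> ?N"
    by (rule CollectI, rule exI[of _ "{}"]) (simp add: Z.independent_empty)
  hence "?N \<noteq> {}" by (rule ex_in_conv[THEN iffD1, OF exI])
  ultimately have "group_rank G \<in> ?N" unfolding group_rank_def by (rule Max_in)
  then obtain B where B: "group_rank G = card B" "B \<subseteq> G" "finite B" "Z.independent B"
    unfolding mem_Collect_eq by (elim exE conjE)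
  show thesis by (rule that[OF B(2,3) ind[OF B(2,4)] B(1)[symmetric]])
qed

lemma add_subgroup_int_scale:
  fixes G :: "'a::real_vector set"
  assumes "add_subgroup G" "x \<in> G"
  shows "of_int k *\<^sub>R x \<in> G"
proof -
  have "real n *\<^sub>R x \<in> G" for n
    by (induction n) (use assms in \<open>auto simp: add_subgroup_def scaleR_add_left\<close>)
  moreover have "- (real n *\<^sub>R x) \<in> G" for n
    using calculation[of n] assms(1) by (simp add: add_subgroup_def)
  ultimately show ?thesis by (cases k rule: int_cases2) simp_all
qed

lemma add_subgroup_sum:
  assumes "add_subgroup G" "\<And>x. x \<in> B \<Longrightarrow> f x \<in> G"
  shows "sum f B \<in> G"
  using assms(2)
  by (induction B rule: infinite_finite_induct) (use assms(1) in \<open>auto simp: add_subgroup_def\<close>)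

text \<open>If \<open>A\<close> sent no nonzero vector of the hyperplane orthogonal to
  \<open>q\<close> into \<open>V\<close>, it would be injective there with image meeting
  \<open>V\<close> only in \<open>0\<close>; the dimensions \<open>CARD('n) - 1\<close> and
  \<open>dim V\<close> would then add up to at most \<open>CARD('m)\<close>.\<close>

lemma exists_unit_vector_into_subspace:
  fixes A :: "real^'n^'m"
  assumes "subspace V" "int (dim V) > int CARD('m) - int CARD('n) + 1" "q \<noteq> 0"
  obtains v where "norm v = 1" "q \<bullet> v = 0" "A *v v \<in> V"
proof -
  define T where "T = {v. q \<bullet> v = 0}"
  have T: "subspace T" "dim T = CARD('n) - 1"
    using subspace_hyperplane[of q] dim_hyperplane[OF assms(3)] by (simp_all add: T_def)
  have lin: "linear ((*v) A)" by simp
  have "\<exists>v\<in>T. A *v v \<in> V \<and> v \<noteq> 0"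
  proof (rule ccontr)
    assume "\<not> ?thesis"
    hence zero: "v = 0" if "v \<in> T" "A *v v \<in> V" for v using that by blast
    have "inj_on ((*v) A) T"
    proof (rule inj_onI)
      fix x y assume "x \<in> T" "y \<in> T" "A *v x = A *v y"
      hence "x - y = 0"
        using subspace_diff[OF T(1)] subspace_0[OF assms(1)]
        by (intro zero) (simp_all add: matrix_vector_mult_diff_distrib)
      thus "x = y" by simp
    qed
    hence "dim ((*v) A ` T) = dim T"
      using T(1) by (intro dim_image_eq[OF lin]) (simp add: span_eq_iff[THEN iffD2])
    moreover have "(*v) A ` T \<inter> V = {0}"
    proof -
      have "(*v) A ` T \<inter> V \<subseteq> {0}" using zero by force
      moreover have "0 \<in> (*v) A ` T \<inter> V"
        using subspace_0[OF assms(1)] imageI[OF subspace_0[OF T(1)], of "(*v) A"] by simp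
      ultimately show ?thesis by blast
    qed
    moreover have "dim {x + y |x y. x \<in> (*v) A ` T \<and> y \<in> V} + dim ((*v) A ` T \<inter> V)
        = dim ((*v) A ` T) + dim V"
      using linear_subspace_image[OF lin T(1)] assms(1) by (rule dim_sums_Int)
    moreover have "dim {x + y |x y. x \<in> (*v) A ` T \<and> y \<in> V} \<le> CARD('m)"
      using dim_subset_UNIV[of "{x + y |x y. x \<in> (*v) A ` T \<and> y \<in> V}"] by simp
    ultimately have "CARD('n) - 1 + dim V \<le> CARD('m)" using T(2) by simp
    thus False using assms(2) by linarith
  qed
  then obtain v where v: "v \<in> T" "A *v v \<in> V" "v \<noteq> 0" by blast
  show thesis
  proof (rule that[of "(1 / norm v) *\<^sub>R v"])
    show "A *v ((1 / norm v) *\<^sub>R v) \<in> V"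
      using subspace_scale[OF assms(1) v(2), of "1 / norm v"] by (simp only: matrix_vector_mult_scaleR)
  qed (use v in \<open>simp_all add: T_def\<close>)
qed

text \<open>Take \<open>v\<close> orthogonal to \<open>q\<close> with \<open>A *v v\<close> in the
  span of an independent \<open>B \<subseteq> P\<close> of maximal size. Rounding down the
  coordinates of \<open>t *\<^sub>R v\<close> and the coefficients of
  \<open>t *\<^sub>R (A *v v)\<close> gives \<open>q'\<close> and \<open>p'\<close> with errors
  bounded independently of \<open>t\<close>.\<close>

lemma approximable_subgroup:
  fixes P :: "(real^'m) set"
  assumes "add_subgroup P" "P \<subseteq> int_lattice"
    and rank: "int (group_rank P) > int CARD('m) - int CARD('n) + 1"
  shows "approximable P (int_lattice - {0} :: (real^'n) set)"
  unfolding approximable_def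
proof (rule ballI)
  let ?Q = "int_lattice - {0} :: (real^'n) set"
  fix q assume "q \<in> ?Q"
  hence "q \<noteq> 0" by simp
  obtain B where B: "B \<subseteq> P" "finite B" "independent B" "card B = group_rank P"
    using group_rank_attained[OF assms(2)] .
  have dimB: "dim (span B) = group_rank P" using B(3,4) by (simp add: dim_eq_card_independent)
  have "\<exists>v C. norm v = 1 \<and> (\<forall>s. 1 \<le> norm (v - s *\<^sub>R q)) \<and>
     (\<forall>T. \<exists>t p' q'. T \<le> \<bar>t\<bar> \<and> p' \<in> P \<and> q' \<in> ?Q \<and>
        norm (q' - t *\<^sub>R v) \<le> C \<and> norm (A *v q' - p') \<le> C)" for A :: "real^'n^'m"
  proof -
    obtain v where v: "norm v = 1" "q \<bullet> v = 0" "A *v v \<in> span B"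
      using exists_unit_vector_into_subspace[of "span B" q A] rank dimB \<open>q \<noteq> 0\<close> by auto
    then obtain c where c: "A *v v = (\<Sum>b\<in>B. c b *\<^sub>R b)"
      using span_finite[OF B(2)] by auto
    have "1 \<le> norm (v - s *\<^sub>R q)" for s
    proof -
      have "1 = v \<bullet> (v - s *\<^sub>R q)"
        using v(1,2) by (simp add: inner_diff_right inner_commute[of v q] norm_eq_1)
      also have "\<dots> \<le> norm v * norm (v - s *\<^sub>R q)" by (rule norm_cauchy_schwarz)
      finally show ?thesis using v(1) by simp
    qed
    moreover define M where "M = real CARD('n)"
    define C where "C = max M (norm A * M + (\<Sum>b\<in>B. norm b))"
    have "\<exists>t p' q'. T \<le> \<bar>t\<bar> \<and> p' \<in> P \<and> q' \<in> ?Q \<and>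
        norm (q' - t *\<^sub>R v) \<le> C \<and> norm (A *v q' - p') \<le> C" for T
    proof -
      \<comment> \<open>As \<open>M\<close> bounds the rounding error, a multiple of the unit vector
        \<open>v\<close> longer than \<open>M\<close> cannot round to zero.\<close>
      define t where "t = max T (M + 1)"
      have t: "T \<le> \<bar>t\<bar>" "M < norm (t *\<^sub>R v)" using v(1) by (auto simp: t_def)
      define q' :: "real^'n" where "q' = (\<chi> i. of_int \<lfloor>t * v $ i\<rfloor>)"
      define p' where "p' = (\<Sum>b\<in>B. of_int \<lfloor>t * c b\<rfloor> *\<^sub>R b)"
      have qt: "norm (q' - t *\<^sub>R v) \<le> M"
      proof -
        have "\<bar>(q' - t *\<^sub>R v) $ i\<bar> \<le> 1" for i
          by (simp add: q'_def) linarith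
        hence "(\<Sum>i\<in>UNIV. \<bar>(q' - t *\<^sub>R v) $ i\<bar>) \<le> (\<Sum>i\<in>(UNIV::'n set). 1)"
          by (intro sum_mono)
        thus ?thesis using norm_le_l1_cart[of "q' - t *\<^sub>R v"] by (simp add: M_def)
      qed
      hence "q' \<noteq> 0" using t(2) by auto
      moreover have "q' \<in> int_lattice" by (simp add: q'_def int_lattice_def)
      moreover have "p' \<in> P"
        unfolding p'_def using B(1) assms(1) by (intro add_subgroup_sum add_subgroup_int_scale) auto
      moreover have "norm (A *v q' - p') \<le> norm A * M + (\<Sum>b\<in>B. norm b)"
      proof -
        have "A *v q' - p' = A *v (q' - t *\<^sub>R v) + (t *\<^sub>R (A *v v) - p')"
          by (simp add: matrix_vector_mult_diff_distrib matrix_vector_mult_scaleR)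
        also have "norm \<dots> \<le> norm (A *v (q' - t *\<^sub>R v)) + norm (t *\<^sub>R (A *v v) - p')"
          by (rule norm_triangle_ineq)
        also have "norm (A *v (q' - t *\<^sub>R v)) \<le> norm A * norm (q' - t *\<^sub>R v)"
          by (rule norm_matrix_vector_mult_le)
        also have "\<dots> \<le> norm A * M" using qt by (intro mult_left_mono) simp_all
        also have "t *\<^sub>R (A *v v) - p' = (\<Sum>b\<in>B. (t * c b - of_int \<lfloor>t * c b\<rfloor>) *\<^sub>R b)"
          by (simp add: c p'_def scaleR_sum_right sum_subtractf scaleR_diff_left)
        also have "norm \<dots> \<le> (\<Sum>b\<in>B. norm b)"
        proof (rule sum_norm_le)
          fix b
          have "\<bar>t * c b - of_int \<lfloor>t * c b\<rfloor>\<bar> \<le> 1" by linarith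
          thus "norm ((t * c b - of_int \<lfloor>t * c b\<rfloor>) *\<^sub>R b) \<le> norm b"
            using mult_right_mono[of _ 1 "norm b"] by fastforce
        qed
        finally show ?thesis by simp
      qed
      ultimately show ?thesis
        using t(1) qt by (intro exI[of _ t] exI[of _ p'] exI[of _ q']) (simp add: C_def le_max_iff_disj)
    qed
    ultimately show ?thesis by - (rule exI[of _ v], rule exI[of _ C], simp add: v(1))
  qed
  thus "\<exists>\<delta>>0. \<forall>A::real^'n^'m. \<exists>v C. norm v = 1 \<and> (\<forall>s. \<delta> \<le> norm (v - s *\<^sub>R q)) \<and>
     (\<forall>T. \<exists>t p' q'. T \<le> \<bar>t\<bar> \<and> p' \<in> P \<and> q' \<in> ?Q \<and>
        norm (q' - t *\<^sub>R v) \<le> C \<and> norm (A *v q' - p') \<le> C)"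
    by (intro exI[of _ "1::real"] conjI allI zero_less_one)
qed

subsection \<open>Zeros of analytic functions on line segments\<close>

text \<open>Local identity theorem: a nonzero coefficient would give \<open>c\<close> a punctured
  neighbourhood free of zeros, so all coefficients vanish.\<close>

lemma power_series_zero_near_limit_point:
  fixes a :: "nat \<Rightarrow> real"
  assumes "r > 0" and sums: "\<And>t. \<bar>t - c\<bar> < r \<Longrightarrow> (\<lambda>k. a k * (t - c) ^ k) sums \<phi> t"
    and lim: "c islimpt {t. \<phi> t = 0}"
  shows "c \<in> interior {t. \<phi> t = 0}"
proof -
  have "a m = 0" for m
  proof (rule ccontr)
    assume "a m \<noteq> 0"
    \<comment> \<open>The factor \<open>t - c\<close> makes the constant term vanish, so that \<open>powser_0_nonzero\<close> applies
      without knowing \<open>\<phi> c = 0\<close>.\<close>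
    define b where "b = case_nat 0 a"
    have "(\<lambda>k. b k * (t - c) ^ k) sums ((t - c) * \<phi> t)" if "\<bar>t - c\<bar> < r" for t
      using sums_Suc[of "\<lambda>k. b k * (t - c) ^ k"] sums_mult[OF sums[OF that], of "t - c"]
      by (simp add: b_def mult_ac)
    moreover have "b (Suc m) \<noteq> 0" using \<open>a m \<noteq> 0\<close> by (simp add: b_def)
    ultimately obtain s where s: "0 < s" "\<And>t. t \<in> cball c s - {c} \<Longrightarrow> (t - c) * \<phi> t \<noteq> 0"
      using powser_0_nonzero[OF \<open>r > 0\<close>, of c b "\<lambda>t. (t - c) * \<phi> t" "Suc m"]
      by (auto simp: real_norm_def)
    obtain t where "t \<noteq> c" "\<phi> t = 0" "dist t c < s"
      using lim s(1) unfolding islimpt_approachable by blast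
    thus False using s(2)[of t] by (simp add: dist_commute)
  qed
  hence "\<phi> t = 0" if "t \<in> ball c r" for t
    using sums[of t] that sums_unique2[OF sums_zero, of "\<phi> t"]
    by (simp add: dist_real_def abs_minus_commute)
  hence "ball c r \<subseteq> {t. \<phi> t = 0}" by blast
  thus ?thesis using \<open>r > 0\<close> by (meson centre_in_ball mem_interior)
qed

text \<open>Identity theorem by connectedness of \<open>{0..1}\<close>: at each of its points the
  zeros either fill a neighbourhood or do not accumulate. Both conditions are open, they exclude
  each other, and the first holds at \<open>0\<close>.\<close>

lemma power_series_zero_on_interval:
  fixes \<phi> :: "real \<Rightarrow> real"
  assumes series: "\<And>s. s \<in> {0..1} \<Longrightarrow> \<exists>r>0. \<exists>a. \<forall>t. \<bar>t - s\<bar> < r \<longrightarrow> (\<lambda>k. a k * (t - s) ^ k) sums \<phi> t"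
    and "\<eta> > 0" and zero: "\<And>t. 0 \<le> t \<Longrightarrow> t < \<eta> \<Longrightarrow> \<phi> t = 0"
  shows "\<phi> 1 = 0"
proof -
  let ?Z = "{t. \<phi> t = 0}"
  let ?V = "- {s. s islimpt ?Z}"
  have "0 islimpt ?Z"
  proof (rule islimpt_subset)
    show "0 islimpt {0<..<\<eta>}" using \<open>\<eta> > 0\<close> by (simp add: islimpt_greaterThanLessThan1)
    show "{0<..<\<eta>} \<subseteq> ?Z" using zero by auto
  qed
  hence "0 \<notin> ?V" by simp
  have cover: "{0..1} \<subseteq> interior ?Z \<union> ?V"
  proof
    fix s :: real assume "s \<in> {0..1}"
    thus "s \<in> interior ?Z \<union> ?V"
      using series power_series_zero_near_limit_point[of _ s _ \<phi>] by blast
  qed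
  have "interior ?Z \<inter> ?V \<inter> {0..1} = {}"
    using interior_limit_point[of _ ?Z] by auto
  moreover have "open ?V" by (simp only: open_Compl closed_limpts)
  ultimately have "interior ?Z \<inter> {0..1} = {} \<or> ?V \<inter> {0..1} = {}"
    using cover connectedD[OF connected_Icc, of "interior ?Z" ?V] by blast
  moreover have "0 \<in> interior ?Z" using subsetD[OF cover, of 0] \<open>0 \<notin> ?V\<close> by simp
  hence "0 \<in> interior ?Z \<inter> {0..1}" by simp
  ultimately have "?V \<inter> {0..1} = {}" by blast
  hence "1 \<in> interior ?Z" using subsetD[OF cover, of 1] by auto
  thus ?thesis using interior_subset[of ?Z] by auto
qed

text \<open>On a line, collecting the finitely many multi-indices \<open>F k\<close> of total degree
  \<open>k\<close> turns the series into one in a single variable; unconditional summability permits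
  the regrouping.\<close>

lemma real_analytic_on_line:
  fixes f :: "'a::euclidean_space \<Rightarrow> 'b::euclidean_space"
  assumes "real_analytic_on f U" "x \<in> U"
  shows "\<exists>r>0. \<exists>a. \<forall>t. \<bar>t\<bar> < r \<longrightarrow> (\<lambda>k. a k * t ^ k) sums (z \<bullet> f (x + t *\<^sub>R v))"
proof -
  obtain r c where r: "r > 0" and c: "\<And>y. y \<in> ball x r \<Longrightarrow>
    ((\<lambda>\<alpha>. (\<Prod>b\<in>Basis. ((y - x) \<bullet> b) ^ \<alpha> b) *\<^sub>R c \<alpha>) has_sum f y) (Basis \<rightarrow>\<^sub>E UNIV)"
    using assms unfolding real_analytic_on_def by blast
  define deg :: "('a \<Rightarrow> nat) \<Rightarrow> nat" where "deg \<alpha> = (\<Sum>b\<in>Basis. \<alpha> b)" for \<alpha>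
  define F where "F k = {\<alpha> \<in> Basis \<rightarrow>\<^sub>E UNIV. deg \<alpha> = k}" for k
  define g where "g \<alpha> = (\<Prod>b\<in>Basis. (v \<bullet> b) ^ \<alpha> b) * (z \<bullet> c \<alpha>)" for \<alpha>
  have fin: "finite (F k)" for k
  proof (rule finite_subset)
    have "\<alpha> b \<le> deg \<alpha>" if "b \<in> Basis" for \<alpha> :: "'a \<Rightarrow> nat" and b
      unfolding deg_def using that by (intro member_le_sum) simp_all
    thus "F k \<subseteq> Basis \<rightarrow>\<^sub>E {..k}"
      unfolding F_def by (intro subsetI PiE_I) (auto simp: PiE_iff extensional_def)
    show "finite (Basis \<rightarrow>\<^sub>E {..k})" by (intro finite_PiE) auto
  qed
  have bij: "bij_betw snd (Sigma UNIV F) (Basis \<rightarrow>\<^sub>E UNIV)"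
    by (rule bij_betwI[where g = "\<lambda>\<alpha>. (deg \<alpha>, \<alpha>)"]) (auto simp: F_def)
  have pos: "norm v + 1 > 0" using norm_ge_zero[of v] by linarith
  have "(\<lambda>k. sum g (F k) * t ^ k) sums (z \<bullet> f (x + t *\<^sub>R v))" if t: "\<bar>t\<bar> < r / (norm v + 1)" for t
  proof -
    have "\<bar>t\<bar> * norm v \<le> \<bar>t\<bar> * (norm v + 1)" by (intro mult_left_mono) auto
    also have "\<dots> < r" using t pos_less_divide_eq[OF pos] by blast
    finally have "x + t *\<^sub>R v \<in> ball x r" by (simp add: dist_norm)
    from has_sum_bounded_linear[where h = "\<lambda>w. z \<bullet> w", OF bounded_linear_inner_right c[OF this]]
    have "((\<lambda>\<alpha>. t ^ deg \<alpha> * g \<alpha>) has_sum (z \<bullet> f (x + t *\<^sub>R v))) (Basis \<rightarrow>\<^sub>E UNIV)"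
      unfolding g_def deg_def power_sum
      by (simp add: power_mult_distrib prod.distrib mult.assoc)
    hence "((\<lambda>x. t ^ deg (snd x) * g (snd x)) has_sum (z \<bullet> f (x + t *\<^sub>R v))) (Sigma UNIV F)"
      using has_sum_reindex_bij_betw[OF bij, of "\<lambda>\<alpha>. t ^ deg \<alpha> * g \<alpha>"] by blast
    hence "((\<lambda>k. sum g (F k) * t ^ k) has_sum (z \<bullet> f (x + t *\<^sub>R v))) UNIV"
    proof (rule has_sum_SigmaD[where B = F and g = "\<lambda>k. sum g (F k) * t ^ k"])
      fix k
      have "(\<Sum>\<alpha>\<in>F k. t ^ deg \<alpha> * g \<alpha>) = (\<Sum>\<alpha>\<in>F k. g \<alpha> * t ^ k)"
        by (rule sum.cong) (auto simp: F_def)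
      thus "((\<lambda>\<alpha>. t ^ deg (snd (k, \<alpha>)) * g (snd (k, \<alpha>))) has_sum sum g (F k) * t ^ k) (F k)"
        using fin by (intro has_sum_finiteI) (simp_all add: sum_distrib_right)
    qed
    thus ?thesis by (rule has_sum_imp_sums)
  qed
  moreover have "r / (norm v + 1) > 0" using r pos by (rule divide_pos_pos)
  ultimately show ?thesis
    by (intro exI[of _ "r / (norm v + 1)"] conjI exI[of _ "\<lambda>k. sum g (F k)"]) simp_all
qed

text \<open>Let \<open>z\<close> be the component of \<open>f b\<close> orthogonal to
  \<open>T\<close>. Otherwise \<open>z \<bullet> f\<close> would vanish on an initial part of the
  segment and, being analytic along it, also at \<open>b\<close>, where its value is
  \<open>z \<bullet> z\<close>.\<close>

lemma real_analytic_on_segment: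
  fixes f :: "'a::euclidean_space \<Rightarrow> 'b::euclidean_space"
  assumes "real_analytic_on f U" "closed_segment a b \<subseteq> U" "subspace T" "f b \<notin> T" "\<eta> > 0"
  shows "\<exists>s. 0 \<le> s \<and> s < \<eta> \<and> f (a + s *\<^sub>R (b - a)) \<notin> T"
proof (rule ccontr)
  assume "\<not> ?thesis"
  hence inT: "f (a + s *\<^sub>R (b - a)) \<in> T" if "0 \<le> s" "s < \<eta>" for s using that by blast
  obtain y z where yz: "y \<in> span T" "\<And>w. w \<in> span T \<Longrightarrow> orthogonal z w" "f b = y + z"
    using orthogonal_subspace_decomp_exists[of T "f b"] by blast
  have "z \<noteq> 0" using yz assms(4) span_eq_iff[THEN iffD2, OF assms(3)] by auto
  have "z \<bullet> f (a + 1 *\<^sub>R (b - a)) = 0"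
  proof (rule power_series_zero_on_interval)
    fix s :: real assume "s \<in> {0..1}"
    moreover have "a + s *\<^sub>R (b - a) = (1 - s) *\<^sub>R a + s *\<^sub>R b" by (simp add: algebra_simps)
    ultimately have "a + s *\<^sub>R (b - a) \<in> closed_segment a b"
      unfolding closed_segment_def by fastforce
    hence "a + s *\<^sub>R (b - a) \<in> U" using assms(2) by blast
    from real_analytic_on_line[OF assms(1) this, of z "b - a"] obtain r c where
      "r > 0" and c: "\<And>t. \<bar>t\<bar> < r \<Longrightarrow>
        (\<lambda>k. c k * t ^ k) sums (z \<bullet> f (a + s *\<^sub>R (b - a) + t *\<^sub>R (b - a)))" by blast
    have "(\<lambda>k. c k * (t - s) ^ k) sums (z \<bullet> f (a + t *\<^sub>R (b - a)))" if "\<bar>t - s\<bar> < r" for t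
    proof -
      have "a + s *\<^sub>R (b - a) + (t - s) *\<^sub>R (b - a) = a + t *\<^sub>R (b - a)"
        by (simp add: scaleR_left_diff_distrib)
      thus ?thesis using c[OF that] by (simp only:)
    qed
    with \<open>r > 0\<close> show "\<exists>r>0. \<exists>c. \<forall>t. \<bar>t - s\<bar> < r \<longrightarrow>
        (\<lambda>k. c k * (t - s) ^ k) sums (z \<bullet> f (a + t *\<^sub>R (b - a)))"
      by (intro exI[of _ r] conjI exI[of _ c]) simp_all
  next
    show "z \<bullet> f (a + t *\<^sub>R (b - a)) = 0" if "0 \<le> t" "t < \<eta>" for t
      using yz(2)[OF span_base[OF inT[OF that]]] by (simp add: orthogonal_def)
  qed fact
  hence "z \<bullet> f b = 0" by simp
  moreover have "z \<bullet> y = 0" using yz(1,2) by (simp add: orthogonal_def)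
  ultimately show False using \<open>z \<noteq> 0\<close> yz(3) by (simp add: inner_add_right)
qed

subsection \<open>Covering submanifolds by thin sets\<close>

text \<open>A submanifold need not be closed, so a ball cannot be chosen to avoid it. It is instead
  split into countably many closed pieces \<open>K\<close>, each with a larger piece \<open>Z\<close> of the same
  submanifold that is used near points of \<open>K\<close>; the last condition is what is left of
  analyticity.\<close>

definition thin :: "'a::euclidean_space set \<Rightarrow> bool" where
  "thin K \<longleftrightarrow> closed K \<and> (\<forall>x\<in>K. \<exists>r>0. \<exists>Z. closed Z \<and> interior Z = {} \<and> K \<subseteq> Z \<and>
     (\<forall>a\<in>ball x r. \<forall>b\<in>ball x r - Z. \<forall>\<eta>>0. \<exists>s. 0 \<le> s \<and> s < \<eta> \<and> a + s *\<^sub>R (b - a) \<notin> Z))"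

lemma thin_empty: "thin {}"
  by (simp add: thin_def)

text \<open>A segment from \<open>x\<close> to another point leaves \<open>x\<close> at once, and
  any other segment starts off \<open>x\<close>. This allows countably many points to be avoided
  along with the submanifolds.\<close>

lemma thin_singleton: "thin {x}"
proof -
  have "\<exists>s. 0 \<le> s \<and> s < \<eta> \<and> a + s *\<^sub>R (b - a) \<notin> {x}" if "b \<noteq> x" "\<eta> > 0" for a b and \<eta> :: real
  proof (cases "a = x")
    case True
    thus ?thesis using that by (intro exI[of _ "\<eta> / 2"]) auto
  next
    case False
    thus ?thesis using that by (intro exI[of _ 0]) auto
  qed
  note segment = this
  show ?thesis
    unfolding thin_def
  proof (intro conjI ballI)
    show "\<exists>r>0. \<exists>Z. closed Z \<and> interior Z = {} \<and> {x} \<subseteq> Z \<and>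
      (\<forall>a\<in>ball y r. \<forall>b\<in>ball y r - Z. \<forall>\<eta>>0. \<exists>s. 0 \<le> s \<and> s < \<eta> \<and> a + s *\<^sub>R (b - a) \<notin> Z)" for y
    proof (intro exI[of _ "{x}"] exI[of _ "1::real"] conjI ballI allI)
      show "\<eta> > 0 \<longrightarrow> (\<exists>s. 0 \<le> s \<and> s < \<eta> \<and> a + s *\<^sub>R (b - a) \<notin> {x})"
        if "b \<in> ball y 1 - {x}" for a b and \<eta> :: real
        using segment[of b \<eta> a] that by blast
    qed simp_all
  qed simp
qed

text \<open>With a chart defined on \<open>cball x e\<close>, the closed piece has radius
  \<open>e / 2\<close> and \<open>Z\<close> is \<open>S \<inter> cball x e\<close>. Within
  \<open>e / 2\<close> of a point of the piece, being outside \<open>Z\<close> means being outside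
  \<open>S\<close>, so the result on segments applies to the chart.\<close>

lemma analytic_submanifold_thin_piece:
  fixes S :: "'a::euclidean_space set"
  assumes "analytic_submanifold d S" "d < DIM('a)" "x \<in> S"
  shows "\<exists>r>0. thin (S \<inter> cball x r)"
proof -
  obtain U V f g T where UV: "open U" "x \<in> U" "open V" "homeomorphism U V f (g :: 'a \<Rightarrow> 'a)"
    "real_analytic_on f U" "subspace T" "dim T = d" "f ` (S \<inter> U) = T \<inter> V"
    using assms(1,3) unfolding analytic_submanifold_def by metis
  have fU: "f y \<in> V" "g (f y) = y" if "y \<in> U" for y
    using UV(4) that unfolding homeomorphism_def by auto
  have gV: "g w \<in> U" "f (g w) = w" if "w \<in> V" for w
    using UV(4) that unfolding homeomorphism_def by auto
  have mem: "y \<in> S \<longleftrightarrow> f y \<in> T" if "y \<in> U" for y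
  proof
    assume "y \<in> S"
    thus "f y \<in> T" using that UV(8) by blast
  next
    assume "f y \<in> T"
    hence "f y \<in> f ` (S \<inter> U)" using fU(1)[OF that] UV(8) by blast
    then obtain y' where "f y = f y'" "y' \<in> S" "y' \<in> U" by blast
    thus "y \<in> S" using fU(2) that by metis
  qed
  obtain e where e: "e > 0" "cball x e \<subseteq> U" using UV(1,2) open_contains_cball by blast
  define r where "r = e / 2"
  have r: "r > 0" "r \<le> e" using e by (auto simp: r_def)
  have cl: "closed (S \<inter> cball x \<rho>)" if "\<rho> \<le> e" for \<rho>
  proof -
    have sub: "cball x \<rho> \<subseteq> U" using that e(2) by (meson order_trans subset_cball)
    hence eq: "S \<inter> cball x \<rho> = cball x \<rho> \<inter> f -` T" using mem[OF subsetD[OF sub]] by auto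
    have "continuous_on U f" using UV(4) unfolding homeomorphism_def by simp
    hence "continuous_on (cball x \<rho>) f" using sub by (rule continuous_on_subset)
    thus ?thesis
      unfolding eq by (intro continuous_closed_preimage closed_subspace[OF UV(6)]) simp_all
  qed
  \<comment> \<open>The chart would carry a nonempty open part of \<open>S\<close> to a nonempty
    open part of \<open>T\<close>, whose dimension is too small.\<close>
  have int: "interior (S \<inter> cball x e) = {}"
  proof (rule ccontr)
    let ?O = "interior (S \<inter> cball x e)"
    assume "?O \<noteq> {}"
    then obtain y where y: "y \<in> ?O" by blast
    have OS: "?O \<subseteq> S" "?O \<subseteq> U" using interior_subset[of "S \<inter> cball x e"] e(2) by auto
    have "V \<inter> g -` ?O \<subseteq> T"
    proof
      fix w assume "w \<in> V \<inter> g -` ?O"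
      hence "w \<in> V" "g w \<in> S" using OS(1) by auto
      thus "w \<in> T" using gV[of w] mem[of "g w"] by simp
    qed
    moreover have "open (V \<inter> g -` ?O)"
      using UV(3,4) unfolding homeomorphism_def by (intro continuous_open_preimage) auto
    moreover have "interior T = {}"
      using empty_interior_lowdim[of T] UV(7) assms(2) by simp
    ultimately have "V \<inter> g -` ?O = {}" using interior_maximal[of "V \<inter> g -` ?O" T] by simp
    moreover have "y \<in> U" using y OS by blast
    hence "f y \<in> V \<inter> g -` ?O" using fU[of y] y by (simp del: interior_Int)
    ultimately show False by blast
  qed
  have seg: "\<exists>s. 0 \<le> s \<and> s < \<eta> \<and> a + s *\<^sub>R (b - a) \<notin> S \<inter> cball x e"
    if y: "y \<in> S \<inter> cball x r" and ab: "a \<in> ball y r" "b \<in> ball y r - (S \<inter> cball x e)" "\<eta> > 0"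
    for y a b and \<eta> :: real
  proof -
    have sub: "ball y r \<subseteq> cball x e"
    proof
      fix w assume "w \<in> ball y r"
      thus "w \<in> cball x e"
        using y dist_triangle[of x w y] by (auto simp: r_def)
    qed
    have "closed_segment a b \<subseteq> ball y r"
      using ab by (intro closed_segment_subset) auto
    hence "closed_segment a b \<subseteq> U" using sub e(2) by blast
    moreover have "b \<in> cball x e" "b \<in> U" using sub ab e(2) by blast+
    moreover from this have "f b \<notin> T" using mem[of b] ab by blast
    ultimately obtain s where s: "0 \<le> s" "s < \<eta>" "f (a + s *\<^sub>R (b - a)) \<notin> T"
      using real_analytic_on_segment[OF UV(5) _ UV(6) _ ab(3)] by blast
    have "a + s *\<^sub>R (b - a) \<notin> S \<inter> cball x e"
      using s(3) mem[of "a + s *\<^sub>R (b - a)"] e(2) by auto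
    thus ?thesis using s(1,2) by (intro exI[of _ s]) simp
  qed
  have "thin (S \<inter> cball x r)"
    unfolding thin_def
  proof (intro conjI ballI)
    show "closed (S \<inter> cball x r)" using cl r(2) by simp
    fix y assume y: "y \<in> S \<inter> cball x r"
    have "\<forall>a\<in>ball y r. \<forall>b\<in>ball y r - (S \<inter> cball x e). \<forall>\<eta>>0.
        \<exists>s. 0 \<le> s \<and> s < \<eta> \<and> a + s *\<^sub>R (b - a) \<notin> S \<inter> cball x e"
      using seg[OF y] by simp
    moreover have "S \<inter> cball x r \<subseteq> S \<inter> cball x e" using subset_cball[OF r(2), of x] by auto
    ultimately show "\<exists>r'>0. \<exists>Z. closed Z \<and> interior Z = {} \<and> S \<inter> cball x r \<subseteq> Z \<and>
      (\<forall>a\<in>ball y r'. \<forall>b\<in>ball y r' - Z. \<forall>\<eta>>0. \<exists>s. 0 \<le> s \<and> s < \<eta> \<and> a + s *\<^sub>R (b - a) \<notin> Z)"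
      using cl[OF order_refl] int r(1)
      by (intro exI[of _ r] conjI exI[of _ "S \<inter> cball x e"])
  qed
  thus ?thesis using r by blast
qed

lemma proper_analytic_submanifold_thin_cover:
  fixes S :: "'a::euclidean_space set"
  assumes "proper_analytic_submanifold S"
  obtains \<K> where "countable \<K>" "\<And>K. K \<in> \<K> \<Longrightarrow> thin K" "S \<subseteq> \<Union>\<K>"
proof -
  obtain d where d: "analytic_submanifold d S" "d < DIM('a)"
    using assms unfolding proper_analytic_submanifold_def by blast
  have "\<forall>x\<in>S. \<exists>r. r > 0 \<and> thin (S \<inter> cball x r)"
    using analytic_submanifold_thin_piece[OF d] by simp
  from bchoice[OF this] obtain r where r: "\<forall>x\<in>S. r x > 0 \<and> thin (S \<inter> cball x (r x))" ..
  have "open B" if "B \<in> (\<lambda>x. ball x (r x)) ` S" for B using that by auto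
  from Lindelof[OF this] obtain \<F> where \<F>: "\<F> \<subseteq> (\<lambda>x. ball x (r x)) ` S" "countable \<F>"
      "\<Union>\<F> = \<Union>((\<lambda>x. ball x (r x)) ` S)" .
  then have "countable \<F> \<and> \<F> \<subseteq> (\<lambda>x. ball x (r x)) ` S" by simp
  then obtain C where C: "countable C" "C \<subseteq> S" "\<F> = (\<lambda>x. ball x (r x)) ` C"
    unfolding countable_subset_image by (elim exE conjE)
  show thesis
  proof (rule that)
    show "countable ((\<lambda>x. S \<inter> cball x (r x)) ` C)" using C by simp
    show "thin K" if "K \<in> (\<lambda>x. S \<inter> cball x (r x)) ` C" for K
      using that r C(2) by auto
    show "S \<subseteq> \<Union>((\<lambda>x. S \<inter> cball x (r x)) ` C)"
    proof
      fix y assume y: "y \<in> S"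
      hence "y \<in> ball y (r y)" using r by simp
      hence "y \<in> \<Union>\<F>" unfolding \<F>(3) using y by (intro UN_I)
      then obtain x where "x \<in> C" "y \<in> ball x (r x)" using C by blast
      thus "y \<in> \<Union>((\<lambda>x. S \<inter> cball x (r x)) ` C)" using y by (intro UN_I[of x]) auto
    qed
  qed
qed

subsection \<open>The nested ball construction\<close>

text \<open>If the space \<open>L'\<close> through \<open>A'\<close> did not leave \<open>K\<close> arbitrarily close to \<open>A'\<close>, then by the
  condition on segments from \<open>A'\<close> every nearby point of \<open>L'\<close> would lie in the nowhere dense set
  \<open>Z\<close> from the definition of \<open>thin\<close>, although such spaces come close to every point of a ball.\<close>

lemma transversal_space:
  fixes A :: "real^'n^'m"
  assumes "approximable P Q" "q \<in> Q" "q \<noteq> 0" "A \<in> solution_space p q" "r > 0" "thin K"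
  obtains p' q' A' where "p' \<in> P" "q' \<in> Q" "N \<le> norm q'"
    "A' \<in> solution_space p' q' \<inter> solution_space p q \<inter> ball A r"
    "\<And>G. open G \<Longrightarrow> A' \<in> G \<Longrightarrow> \<exists>A''. A'' \<in> solution_space p' q' \<and> A'' \<in> G - K"
proof (cases "A \<in> K")
  case False
  \<comment> \<open>Off the closed set \<open>K\<close> it suffices to stay close to
    \<open>A\<close>; then \<open>A'\<close> itself avoids \<open>K\<close>.\<close>
  have "open (- K)" using \<open>thin K\<close> by (simp add: thin_def open_Compl)
  then obtain e where e: "e > 0" "ball A e \<subseteq> - K" using False by (metis ComplI openE)
  obtain \<rho> where \<rho>: "\<rho> > 0"
    "\<And>B \<epsilon> N. B \<in> ball A \<rho> \<Longrightarrow> \<epsilon> > 0 \<Longrightarrow> \<exists>p'\<in>P. \<exists>q'\<in>Q. \<exists>A' B'. N \<le> norm q' \<and>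
       A' \<in> solution_space p' q' \<inter> solution_space p q \<inter> ball A (min r e) \<and>
       B' \<in> solution_space p' q' \<inter> ball B \<epsilon>"
  proof (rule solution_spaces_locally_dense[OF assms(1-4), of "min r e"])
    show "min r e > 0" using assms(5) e(1) by simp
  qed (rule that)
  obtain p' q' A' where *: "p' \<in> P" "q' \<in> Q" "N \<le> norm q'"
      "A' \<in> solution_space p' q' \<inter> solution_space p q \<inter> ball A (min r e)"
    using \<rho>(2)[of A 1 N] \<rho>(1) by auto
  hence "A' \<in> ball A e" by simp
  hence "A' \<notin> K" using e(2) by blast
  show thesis
  proof (rule that[of p' q' A'])
    show "\<exists>A''. A'' \<in> solution_space p' q' \<and> A'' \<in> G - K" if "A' \<in> G" for G
      using that * \<open>A' \<notin> K\<close> by (intro exI[of _ A']) simp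
  qed (use * in simp_all)
next
  case True
  from bspec[OF conjunct2[OF \<open>thin K\<close>[unfolded thin_def]] True]
  obtain e Z where e: "e > 0" "closed Z" "interior Z = {}" "K \<subseteq> Z"
    and seg: "\<forall>a\<in>ball A e. \<forall>b\<in>ball A e - Z. \<forall>\<eta>>0. \<exists>s. 0 \<le> s \<and> s < \<eta> \<and> a + s *\<^sub>R (b - a) \<notin> Z"
    by (elim exE conjE) (rule that)
  obtain \<rho> where \<rho>: "\<rho> > 0"
    "\<And>B \<epsilon> N. B \<in> ball A \<rho> \<Longrightarrow> \<epsilon> > 0 \<Longrightarrow> \<exists>p'\<in>P. \<exists>q'\<in>Q. \<exists>A' B'. N \<le> norm q' \<and>
       A' \<in> solution_space p' q' \<inter> solution_space p q \<inter> ball A (min r e) \<and>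
       B' \<in> solution_space p' q' \<inter> ball B \<epsilon>"
  proof (rule solution_spaces_locally_dense[OF assms(1-4), of "min r e"])
    show "min r e > 0" using assms(5) e(1) by simp
  qed (rule that)
  \<comment> \<open>As \<open>Z\<close> is closed with empty interior, there is a target
    \<open>B\<close> off \<open>Z\<close>, and a small ball around it keeps \<open>B'\<close> off
    \<open>Z\<close> too.\<close>
  have "\<not> ball A (min e \<rho>) \<subseteq> Z"
  proof
    assume "ball A (min e \<rho>) \<subseteq> Z"
    hence "ball A (min e \<rho>) \<subseteq> interior Z" by (rule interior_maximal) simp
    thus False using e(1,3) \<rho>(1) by simp
  qed
  then obtain B where B: "B \<in> ball A (min e \<rho>)" "B \<notin> Z" by blast
  have "open (ball A e - Z)" using e(2) by (simp add: open_Diff)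
  moreover have "B \<in> ball A e - Z" using B by simp
  ultimately obtain \<epsilon> where \<epsilon>: "\<epsilon> > 0" "ball B \<epsilon> \<subseteq> ball A e - Z" by (rule openE)
  have "B \<in> ball A \<rho>" using B by simp
  then obtain p' q' A' B' where *: "p' \<in> P" "q' \<in> Q" "N \<le> norm q'"
      "A' \<in> solution_space p' q' \<inter> solution_space p q \<inter> ball A (min r e)"
      "B' \<in> solution_space p' q' \<inter> ball B \<epsilon>"
    using \<rho>(2)[of B \<epsilon> N] \<epsilon>(1) by auto
  show thesis
  proof (rule that[of p' q' A'])
    fix G assume "open G" "A' \<in> G"
    then obtain \<eta> where \<eta>: "\<eta> > 0" "ball A' \<eta> \<subseteq> G" by (rule openE)
    have pos: "norm (B' - A') + 1 > 0" using norm_ge_zero[of "B' - A'"] by linarith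
    have "A' \<in> ball A e" "B' \<in> ball A e - Z" using * \<epsilon>(2) by auto
    moreover have "\<eta> / (norm (B' - A') + 1) > 0" using \<eta>(1) pos by (rule divide_pos_pos)
    ultimately have "\<exists>s. 0 \<le> s \<and> s < \<eta> / (norm (B' - A') + 1) \<and> A' + s *\<^sub>R (B' - A') \<notin> Z"
      by (intro seg[rule_format])
    then obtain s where s: "0 \<le> s" "s < \<eta> / (norm (B' - A') + 1)" "A' + s *\<^sub>R (B' - A') \<notin> Z"
      by blast
    have "s * norm (B' - A') \<le> s * (norm (B' - A') + 1)" using s(1) by (intro mult_left_mono) simp_all
    also have "\<dots> < \<eta>" using s(2) pos_less_divide_eq[OF pos] by simp
    finally have "A' + s *\<^sub>R (B' - A') \<in> ball A' \<eta>" using s(1) by (simp add: dist_norm)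
    hence "A' + s *\<^sub>R (B' - A') \<in> G - K" using \<eta>(2) e(4) s(3) by blast
    \<comment> \<open>The space is affine, so it contains the whole line through \<open>A'\<close>
      and \<open>B'\<close>, whatever the size of \<open>s\<close>.\<close>
    moreover have "A' + s *\<^sub>R (B' - A') \<in> solution_space p' q'"
      using *(4,5) by (simp add: solution_space_def matrix_vector_mult_add_rdistrib
          matrix_vector_mult_diff_rdistrib scaleR_matrix_vector_assoc[symmetric])
    ultimately show "\<exists>A''. A'' \<in> solution_space p' q' \<and> A'' \<in> G - K" by (intro exI conjI)
  qed (use * in simp_all)
qed

text \<open>One step of the nesting. The old pair \<open>(p, q)\<close> is accurate to within
  \<open>\<psi> (infnorm q')\<close> on an open set \<open>G\<close> around a common point
  \<open>A0\<close> of the two spaces; inside \<open>G\<close> the new space has a point off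
  \<open>K\<close>, and a small closed ball around it is taken.\<close>

lemma next_ball:
  fixes A :: "real^'n^'m"
  assumes "approximable P Q" "0 \<notin> Q" "\<And>t. t > 0 \<Longrightarrow> \<psi> t > 0"
    and "q \<in> Q" "A \<in> solution_space p q" "r > 0" "thin K"
  obtains p' q' A' r' where "p' \<in> P" "q' \<in> Q" "A' \<in> solution_space p' q'" "r' > 0"
    "cball A' r' \<subseteq> cball A r - K" "N \<le> infnorm q'"
    "\<And>X. X \<in> cball A' r' \<Longrightarrow> infnorm (X *v q - p) \<le> \<psi> (infnorm q')"
proof -
  have "q \<noteq> 0" using assms(2,4) by blast
  obtain p' q' A0 where *: "p' \<in> P" "q' \<in> Q" "sqrt (real CARD('n)) * max 1 N \<le> norm q'"
      "A0 \<in> solution_space p' q' \<inter> solution_space p q \<inter> ball A r"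
    and leave: "\<And>G. open G \<Longrightarrow> A0 \<in> G \<Longrightarrow> \<exists>A'. A' \<in> solution_space p' q' \<and> A' \<in> G - K"
    using transversal_space[OF assms(1,4) \<open>q \<noteq> 0\<close> assms(5,6,7),
        where N = "sqrt (real CARD('n)) * max 1 N"] by metis
  \<comment> \<open>The factor \<open>sqrt (real CARD('n))\<close> converts the Euclidean bound into
    one for \<open>infnorm\<close>; the \<open>1\<close> keeps the argument of \<open>\<psi>\<close>
    positive.\<close>
  have "sqrt (real CARD('n)) * max 1 N \<le> sqrt (real CARD('n)) * infnorm q'"
    using order_trans[OF *(3) norm_le_infnorm[of q']] by simp
  moreover have "sqrt (real CARD('n)) > 0" by simp
  ultimately have q': "max 1 N \<le> infnorm q'" using mult_le_cancel_left_pos by blast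
  hence pos: "\<psi> (infnorm q') > 0" using assms(3) by simp
  define G where "G = ball A r \<inter> {X. norm (X *v q - p) < \<psi> (infnorm q')}"
  have "continuous_on UNIV (\<lambda>X::real^'n^'m. X *v q)"
    unfolding matrix_vector_mult_def by (intro continuous_intros)
  hence "open {X :: real^'n^'m. norm (X *v q - p) < \<psi> (infnorm q')}"
    by (intro open_Collect_less continuous_intros)
  hence "open G" by (simp add: G_def open_Int)
  moreover have "A0 \<in> G" using *(4) pos by (simp add: G_def solution_space_def)
  ultimately obtain A' where A': "A' \<in> solution_space p' q'" "A' \<in> G - K" using leave by metis
  have "open (G - K)" using \<open>open G\<close> \<open>thin K\<close> by (simp add: thin_def open_Diff)
  then obtain r' where r': "r' > 0" "cball A' r' \<subseteq> G - K" using A'(2) open_contains_cball by metis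
  show thesis
  proof (rule that[of p' q' A' r'])
    have "G \<subseteq> cball A r" by (auto simp: G_def)
    thus "cball A' r' \<subseteq> cball A r - K" using r'(2) by blast
    show "infnorm (X *v q - p) \<le> \<psi> (infnorm q')" if "X \<in> cball A' r'" for X
    proof -
      have "X \<in> G" using that r'(2) by blast
      thus ?thesis using infnorm_le_norm[of "X *v q - p"] by (simp add: G_def)
    qed
  qed (use * A' r' q' in simp_all)
qed

section \<open>Density and uncountability of the points obtained by nesting\<close>

lemma UA_avoiding_thin_sets_dense:
  fixes P :: "(real^'m) set" and Q :: "(real^'n) set"
  assumes "approximable P Q" "Q \<noteq> {}" "0 \<notin> Q" "\<And>t. t > 0 \<Longrightarrow> \<psi> t > 0" "antimono_on {0<..} \<psi>"
    and "countable \<K>" and thin: "\<And>K. K \<in> \<K> \<Longrightarrow> thin K"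
  shows "closure (UA P Q \<psi> - \<Union>\<K>) = UNIV"
proof -
  define K where "K = from_nat_into (insert {} \<K>)"
  have K: "thin (K n)" for n
    using from_nat_into[of "insert {} \<K>" n] thin thin_empty by (auto simp: K_def)
  have rK: "\<Union>\<K> \<subseteq> (\<Union>n. K n)"
    using range_from_nat_into[of "insert {} \<K>"] assms(6) by (auto simp: K_def)
  have "\<exists>X \<in> UA P Q \<psi> - \<Union>\<K>. dist X B < \<epsilon>" if "\<epsilon> > 0" for B \<epsilon>
  proof -
    obtain p0 q0 A0 where init: "p0 \<in> P" "q0 \<in> Q" "A0 \<in> solution_space p0 q0" "dist A0 B < \<epsilon> / 2"
      using solution_spaces_dense[OF assms(1,2), of "\<epsilon> / 2" B] \<open>\<epsilon> > 0\<close> by auto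
    define good where "good n x \<longleftrightarrow> (case x of (p, q, A, r) \<Rightarrow> p \<in> P \<and> q \<in> Q \<and>
      A \<in> solution_space p q \<and> 0 < r \<and> cball A r \<subseteq> cball A0 (\<epsilon> / 2))"
      for n :: nat and x :: "(real^'m) \<times> (real^'n) \<times> (real^'n^'m) \<times> real"
    \<comment> \<open>The estimate combines the old pair with the new norm because the old pair has
      to serve until the new one takes over.\<close>
    define succ where "succ n x y \<longleftrightarrow> (case (x, y) of ((p, q, A, r), (p', q', A', r')) \<Rightarrow>
      cball A' r' \<subseteq> cball A r - K n \<and> real n \<le> infnorm q' \<and>
      (\<forall>X\<in>cball A' r'. infnorm (X *v q - p) \<le> \<psi> (infnorm q')))"
      for n :: nat and x y :: "(real^'m) \<times> (real^'n) \<times> (real^'n^'m) \<times> real"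
    have "\<exists>f. \<forall>n. good n (f n) \<and> succ n (f n) (f (Suc n))"
    proof (rule dependent_nat_choice)
      show "\<exists>x. good 0 x"
        using init \<open>\<epsilon> > 0\<close> by (intro exI[of _ "(p0, q0, A0, \<epsilon> / 2)"]) (simp add: good_def)
    next
      fix x n assume x: "good n x"
      obtain p q A r where [simp]: "x = (p, q, A, r)" by (cases x)
      have "q \<in> Q" "A \<in> solution_space p q" "r > 0" and sub: "cball A r \<subseteq> cball A0 (\<epsilon> / 2)"
        using x by (simp_all add: good_def)
      obtain p' q' A' r' where "p' \<in> P" "q' \<in> Q" "A' \<in> solution_space p' q'" "r' > 0"
          "cball A' r' \<subseteq> cball A r - K n" "real n \<le> infnorm q'"
          "\<And>X. X \<in> cball A' r' \<Longrightarrow> infnorm (X *v q - p) \<le> \<psi> (infnorm q')"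
      proof (rule next_ball[where N = "real n", OF assms(1,3) _ \<open>q \<in> Q\<close> \<open>A \<in> solution_space p q\<close> \<open>r > 0\<close> K[of n]])
        show "\<psi> t > 0" if "t > 0" for t using assms(4) that .
      qed (rule that)
      moreover from this sub have "cball A' r' \<subseteq> cball A0 (\<epsilon> / 2)" by blast
      ultimately show "\<exists>y. good (Suc n) y \<and> succ n x y"
        by (intro exI[of _ "(p', q', A', r')"]) (simp add: good_def succ_def)
    qed
    then obtain f where f: "\<And>n. good n (f n)" "\<And>n. succ n (f n) (f (Suc n))" by blast
    define p q A r where "p n = fst (f n)" and "q n = fst (snd (f n))" and
      "A n = fst (snd (snd (f n)))" and "r n = snd (snd (snd (f n)))" for n
    have pq: "p n \<in> P" "q n \<in> Q" "r n > 0" "cball (A n) (r n) \<subseteq> cball A0 (\<epsilon> / 2)" for n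
      using f(1)[of n] by (auto simp: good_def p_def q_def A_def r_def split: prod.splits)
    have step: "cball (A (Suc n)) (r (Suc n)) \<subseteq> cball (A n) (r n) - K n"
        "real n \<le> infnorm (q (Suc n))"
        "\<And>X. X \<in> cball (A (Suc n)) (r (Suc n)) \<Longrightarrow> infnorm (X *v q n - p n) \<le> \<psi> (infnorm (q (Suc n)))" for n
      using f(2)[of n] by (auto simp: succ_def p_def q_def A_def r_def split: prod.splits)
    have dec: "cball (A n) (r n) \<subseteq> cball (A m) (r m)" if "m \<le> n" for m n
      using that by (rule lift_Suc_antimono_le[rotated]) (use step(1) in blast)
    have "(\<Inter>n. cball (A n) (r n)) \<noteq> {}"
    proof (rule compact_nest)
      show "cball (A n) (r n) \<noteq> {}" for n using pq(3)[of n] by simp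
    qed (use dec in simp_all)
    then obtain X where X: "X \<in> cball (A n) (r n)" for n by blast
    have "X \<notin> K n" for n using X[of "Suc n"] step(1)[of n] by blast
    hence "X \<notin> \<Union>\<K>" using rK by blast
    moreover have "X \<in> UA P Q \<psi>"
      unfolding UA_def mem_Collect_eq
    proof (rule eventually_at_top_linorderI)
      fix t assume t: "max 1 (infnorm (q 0)) \<le> t"
      \<comment> \<open>The norms of the \<open>q n\<close> are unbounded but perhaps not
        increasing, hence the first index with norm above \<open>t\<close>. As \<open>t\<close> is
        at least \<open>infnorm (q 0)\<close>, this index is positive, and the pair just before it
        serves \<open>t\<close>.\<close>
      define j where "j = (LEAST j. t < infnorm (q j))"
      have ex: "t < infnorm (q (Suc (nat \<lceil>t\<rceil> + 1)))"
        using step(2)[of "nat \<lceil>t\<rceil> + 1"] by linarith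
      have j: "t < infnorm (q j)" unfolding j_def using ex by (rule LeastI)
      then obtain i where i: "j = Suc i" using t by (cases j) auto
      have "\<not> t < infnorm (q i)"
        using not_less_Least[of i "\<lambda>j. t < infnorm (q j)"] i by (simp add: j_def)
      hence "infnorm (q i) \<le> t" by simp
      moreover have "infnorm (X *v q i - p i) \<le> \<psi> (infnorm (q (Suc i)))"
        using step(3) X by blast
      moreover have "\<psi> (infnorm (q (Suc i))) \<le> \<psi> t"
        using assms(5) t j by (auto simp: monotone_on_def i)
      ultimately show "\<exists>p\<in>P. \<exists>q\<in>Q. infnorm (X *v q - p) \<le> \<psi> t \<and> infnorm q \<le> t"
        using pq(1,2) by (intro bexI[of _ "p i"] bexI[of _ "q i"]) auto
    qed
    moreover have "dist X B < \<epsilon>"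
    proof -
      have "dist A0 X \<le> \<epsilon> / 2" using X[of 0] pq(4)[of 0] by auto
      thus ?thesis using init(4) dist_triangle[of X B A0] by (simp add: dist_commute)
    qed
    ultimately show ?thesis by blast
  qed
  thus ?thesis by (auto simp: closure_approachable)
qed

lemma UA_avoiding_submanifolds:
  fixes P :: "(real^'m) set" and Q :: "(real^'n) set"
  assumes "approximable P Q" "Q \<noteq> {}" "0 \<notin> Q" "\<And>t. t > 0 \<Longrightarrow> \<psi> t > 0" "antimono_on {0<..} \<psi>"
    and "countable \<R>" and "\<And>R. R \<in> \<R> \<Longrightarrow> proper_analytic_submanifold R"
  shows "uncountable (UA P Q \<psi> - \<Union>\<R>)" "closure (UA P Q \<psi> - \<Union>\<R>) = UNIV"
proof -
  have "\<forall>R\<in>\<R>. \<exists>\<K>. countable \<K> \<and> (\<forall>K\<in>\<K>. thin K) \<and> R \<subseteq> \<Union>\<K>"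
  proof
    fix R assume "R \<in> \<R>"
    obtain \<K> where "countable \<K>" "\<And>K. K \<in> \<K> \<Longrightarrow> thin K" "R \<subseteq> \<Union>\<K>"
      by (rule proper_analytic_submanifold_thin_cover[OF assms(7)[OF \<open>R \<in> \<R>\<close>]]) (rule that)
    thus "\<exists>\<K>. countable \<K> \<and> (\<forall>K\<in>\<K>. thin K) \<and> R \<subseteq> \<Union>\<K>" by (intro exI[of _ \<K>]) simp
  qed
  from bchoice[OF this] obtain \<K> where
    \<K>: "\<forall>R\<in>\<R>. countable (\<K> R) \<and> (\<forall>K\<in>\<K> R. thin K) \<and> R \<subseteq> \<Union>(\<K> R)" ..
  define \<T> where "\<T> = \<Union>(\<K> ` \<R>)"
  have "countable \<T>"
    unfolding \<T>_def using \<K> assms(6) by (intro countable_UN) simp_all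
  moreover have "thin K" if K: "K \<in> \<T>" for K
  proof -
    obtain R where "R \<in> \<R>" "K \<in> \<K> R" using K unfolding \<T>_def by blast
    with bspec[OF \<K>] show ?thesis by simp
  qed
  ultimately have \<T>: "countable \<T>" "\<And>K. K \<in> \<T> \<Longrightarrow> thin K" .
  have cover: "\<Union>\<R> \<subseteq> \<Union>\<T>"
  proof
    fix x assume "x \<in> \<Union>\<R>"
    then obtain R where "R \<in> \<R>" "x \<in> R" by blast
    hence "x \<in> \<Union>(\<K> R)" using bspec[OF \<K> \<open>R \<in> \<R>\<close>] by fast
    thus "x \<in> \<Union>\<T>" using \<open>R \<in> \<R>\<close> unfolding \<T>_def by fast
  qed
  \<comment> \<open>The free countable set \<open>C\<close> gives uncountability: if the resulting
    set were countable, taking it for \<open>C\<close> would leave nothing, which is not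
    dense.\<close>
  have dense: "closure (UA P Q \<psi> - (\<Union>\<T> \<union> C)) = UNIV" if "countable C" for C
  proof -
    have "closure (UA P Q \<psi> - \<Union>(\<T> \<union> (\<lambda>x. {x}) ` C)) = UNIV"
    proof (rule UA_avoiding_thin_sets_dense[OF assms(1-3) _ assms(5)])
      show "\<psi> t > 0" if "t > 0" for t using assms(4) that .
      show "countable (\<T> \<union> (\<lambda>x. {x}) ` C)" using \<T>(1) that by simp
      fix K assume "K \<in> \<T> \<union> (\<lambda>x. {x}) ` C"
      thus "thin K" using \<T>(2) thin_singleton by (elim UnE imageE) simp_all
    qed
    moreover have "\<Union>(\<T> \<union> (\<lambda>x. {x}) ` C) = \<Union>\<T> \<union> C" by auto
    ultimately show ?thesis by simp
  qed
  have "UA P Q \<psi> - (\<Union>\<T> \<union> {}) \<subseteq> UA P Q \<psi> - \<Union>\<R>" using cover by auto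
  from closure_mono[OF this] show "closure (UA P Q \<psi> - \<Union>\<R>) = UNIV"
    using dense[of "{}"] by (simp add: top.extremum_unique)
  show "uncountable (UA P Q \<psi> - \<Union>\<R>)"
  proof
    assume "countable (UA P Q \<psi> - \<Union>\<R>)"
    note dense = dense[OF this]
    have "UA P Q \<psi> - (\<Union>\<T> \<union> (UA P Q \<psi> - \<Union>\<R>)) = {}" using cover by auto
    from dense[unfolded this] show False by simp
  qed
qed

theorem theorem1p5:
  fixes P :: "(real^'m) set" and Q :: "(real^'n) set"
  assumes "0 \<notin> Q"
    and "(Q = int_lattice - {0} \<and> add_subgroup P \<and> P \<subseteq> int_lattice \<and>
            int (group_rank P) > int CARD('m) - int CARD('n) + 1)
         \<or>
         ((\<exists>Qs :: 'n \<Rightarrow> int set.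
             (\<forall>i. Qs i \<noteq> {}) \<and>
             (\<exists>i j. i \<noteq> j \<and> infinite (Qs i) \<and> infinite (Qs j)) \<and>
             Q = {q. \<forall>i. q $ i \<in> real_of_int ` Qs i} - {0}) \<and>
          (\<exists>R>0. \<forall>x. \<exists>p\<in>P. dist x p \<le> R))"
  shows "totally_dense (solution_spaces P Q) \<and>
    (\<forall>(\<psi> :: real \<Rightarrow> real) (\<R> :: (real^'n^'m) set set).
       (\<forall>t>0. \<psi> t > 0) \<longrightarrow> antimono_on {0<..} \<psi> \<longrightarrow>
       countable \<R> \<longrightarrow> (\<forall>R\<in>\<R>. proper_analytic_submanifold R) \<longrightarrow>
       uncountable (UA P Q \<psi> - \<Union>\<R>) \<and> closure (UA P Q \<psi> - \<Union>\<R>) = UNIV)"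
proof -
  \<comment> \<open>The two alternatives enter only through approximability and the existence of a
    point of \<open>Q\<close>.\<close>
  have Q: "approximable P Q \<and> Q \<noteq> {}"
    using assms(2)
  proof (elim disjE conjE exE)
    assume Q: "Q = int_lattice - {0}" and P: "add_subgroup P" "P \<subseteq> int_lattice"
      "int (group_rank P) > int CARD('m) - int CARD('n) + 1"
    have "axis k 1 \<in> Q" for k
      by (simp add: Q int_lattice_def axis_def vec_eq_iff)
    hence "Q \<noteq> {}" by blast
    moreover have "approximable P Q" unfolding Q by (rule approximable_subgroup[OF P])
    ultimately show ?thesis by blast
  next
    fix R Qs i j
    assume Qs: "\<forall>i. Qs i \<noteq> {}" "i \<noteq> j" "infinite (Qs i)" "infinite (Qs j)"
      and Q: "Q = {q. \<forall>i. q $ i \<in> real_of_int ` Qs i} - {0}"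
      and P: "\<forall>x. \<exists>p\<in>P. dist x p \<le> R"
    have "approximable P Q"
      unfolding Q using Qs P by (intro approximable_product[of Qs i j P R]) simp_all
    moreover have "Q \<noteq> {}"
    proof -
      have "\<not> Qs i \<subseteq> {0}" using Qs(3) finite_subset by blast
      then obtain z where z: "z \<in> Qs i" "z \<noteq> 0" by blast
      define c where "c = (\<lambda>k. SOME z. z \<in> Qs k)(i := z)"
      have "c k \<in> Qs k" for k using z(1) Qs(1) by (simp add: c_def some_in_eq)
      hence "(\<chi> k. real_of_int (c k)) \<in> Q"
        using z(2) by (auto simp: Q vec_eq_iff c_def intro!: exI[of _ i])
      thus ?thesis by blast
    qed
    ultimately show ?thesis by blast
  qed
  show ?thesis
  proof (intro conjI allI impI)
    show "totally_dense (solution_spaces P Q)"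
      using approximable_imp_totally_dense Q assms(1) by blast
  next
    fix \<psi> :: "real \<Rightarrow> real" and \<R> :: "(real^'n^'m) set set"
    assume "\<forall>t>0. \<psi> t > 0" "antimono_on {0<..} \<psi>" "countable \<R>"
      "\<forall>R\<in>\<R>. proper_analytic_submanifold R"
    thus "uncountable (UA P Q \<psi> - \<Union>\<R>)" "closure (UA P Q \<psi> - \<Union>\<R>) = UNIV"
      using UA_avoiding_submanifolds[of P Q \<psi> \<R>] Q assms(1) by simp_all
  qed
qed

end
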